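(* Let $a_n$ be the number of loops of length $2n$ in the standard Cayley graph of Thompson's group $F$. Then for any real numbers $a<1$ and $\lambda>1$, the inequality $$a_n < 16^n\,\lambda^{-n^a}$$ holds for all sufficiently large integers $n$.
   Context: Thompson's group $F$ is the group with presentation $$F=\langle x,y \mid x^{2}yx^{-2}=yxyx^{-1}y^{-1},\ x^{3}yx^{-3}=yx^{2}yx^{-2}y^{-1}\rangle .$$ The standard Cayley graph of $F$ is its Cayley graph with respect to the inverse-closed generating set $S=\{x,y,x^{-1},y^{-1}\}$. A loop of length $m$ means a closed walk of length $m$ starting and ending at the identity; equivalently, $a_n$ is the number of words of length $2n$ over the four-letter alphabet $S$ that represent the identity of $F$. The sequence $(a_n)$ is called the cogrowth sequence of $F$. *)

theory Defs
  imports Complex_Main "HOL-Algebra.Group" "Graph_Theory.Arc_Walk"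
begin

section \<open>Groups given by generators and relations\<close>

text \<open>
  A letter \<open>(a, True)\<close> stands for the generator \<open>a\<close> and \<open>(a, False)\<close> for its formal inverse.
  A pair \<open>(u, v)\<close> in the set \<open>R\<close> of relations stands for the relation \<open>u = v\<close>.
\<close>

type_synonym 'a word = "('a \<times> bool) list"

inductive word_eq :: "('a word \<times> 'a word) set \<Rightarrow> 'a word \<Rightarrow> 'a word \<Rightarrow> bool"
  for R where
  refl: "word_eq R u u"
| sym: "word_eq R u v \<Longrightarrow> word_eq R v u"
| trans: "word_eq R u v \<Longrightarrow> word_eq R v w \<Longrightarrow> word_eq R u w"
| append: "word_eq R u u' \<Longrightarrow> word_eq R v v' \<Longrightarrow> word_eq R (u @ v) (u' @ v')"
| cancel: "word_eq R [(a, b), (a, \<not> b)] []"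
| relation: "(u, v) \<in> R \<Longrightarrow> word_eq R u v"

definition word_rel :: "('a word \<times> 'a word) set \<Rightarrow> ('a word \<times> 'a word) set" where
  "word_rel R = {(u, v). word_eq R u v}"

definition word_class :: "('a word \<times> 'a word) set \<Rightarrow> 'a word \<Rightarrow> 'a word set" where
  "word_class R u = word_rel R `` {u}"

definition presented_group :: "('a word \<times> 'a word) set \<Rightarrow> 'a word set monoid" where
  "presented_group R =
     \<lparr>carrier = UNIV // word_rel R,
      mult = (\<lambda>A B. \<Union>u\<in>A. \<Union>v\<in>B. word_class R (u @ v)),
      one = word_class R []\<rparr>"

lemma equiv_word_rel: "equiv UNIV (word_rel R)"
  by (rule equivI)
    (auto simp: word_rel_def refl_on_def sym_def trans_def
      intro: word_eq.refl word_eq.sym word_eq.trans)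

lemma word_class_eq_iff: "word_class R u = word_class R v \<longleftrightarrow> word_eq R u v"
  unfolding word_class_def
  using eq_equiv_class_iff[OF equiv_word_rel, of u v R] by (simp add: word_rel_def)

lemma carrier_presented_group: "carrier (presented_group R) = range (word_class R)"
  by (auto simp: presented_group_def quotient_def word_class_def)

lemma mult_presented_group:
  "word_class R u \<otimes>\<^bsub>presented_group R\<^esub> word_class R v = word_class R (u @ v)"
proof -
  have "word_class R (u' @ v') = word_class R (u @ v)"
    if "u' \<in> word_class R u" "v' \<in> word_class R v" for u' v'
    using that unfolding word_class_eq_iff
    by (auto simp: word_class_def word_rel_def intro: word_eq.append word_eq.sym)
  moreover have "u \<in> word_class R u" "v \<in> word_class R v"
    by (auto simp: word_class_def word_rel_def intro: word_eq.refl)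
  ultimately have "(\<Union>u'\<in>word_class R u. \<Union>v'\<in>word_class R v. word_class R (u' @ v')) =
      word_class R (u @ v)"
    by blast
  thus ?thesis
    by (simp add: presented_group_def)
qed

lemma one_presented_group: "\<one>\<^bsub>presented_group R\<^esub> = word_class R []"
  by (simp add: presented_group_def)

definition word_inverse :: "'a word \<Rightarrow> 'a word" where
  "word_inverse w = rev (map (\<lambda>(a, b). (a, \<not> b)) w)"

lemma word_eq_inverse: "word_eq R (word_inverse w @ w) []"
proof (induction w)
  case Nil
  show ?case by (simp add: word_inverse_def word_eq.refl)
next
  case (Cons l w)
  obtain a b where l: "l = (a, b)" by (cases l)
  have "word_eq R [(a, \<not> b), (a, b)] []"
    using word_eq.cancel[of R a "\<not> b"] by simp
  hence "word_eq R (word_inverse w @ ([(a, \<not> b), (a, b)] @ w)) (word_inverse w @ ([] @ w))"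
    by (intro word_eq.append word_eq.refl)
  with Cons show ?case
    by (auto simp: word_inverse_def l intro: word_eq.trans)
qed

lemma group_presented_group: "group (presented_group R)"
proof (rule groupI)
  fix x assume "x \<in> carrier (presented_group R)"
  then obtain w where w: "x = word_class R w" by (auto simp: carrier_presented_group)
  have "word_class R (word_inverse w) \<otimes>\<^bsub>presented_group R\<^esub> x = \<one>\<^bsub>presented_group R\<^esub>"
    by (simp add: w mult_presented_group one_presented_group word_class_eq_iff word_eq_inverse)
  thus "\<exists>y\<in>carrier (presented_group R). y \<otimes>\<^bsub>presented_group R\<^esub> x = \<one>\<^bsub>presented_group R\<^esub>"
    by (rule bexI) (simp add: carrier_presented_group)
qed (auto simp: carrier_presented_group mult_presented_group one_presented_group)

lemma inv_presented_group:
  "inv\<^bsub>presented_group R\<^esub> (word_class R w) = word_class R (word_inverse w)"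
proof -
  interpret group "presented_group R" by (rule group_presented_group)
  show ?thesis
    by (rule inv_equality)
      (auto simp: carrier_presented_group mult_presented_group one_presented_group
        word_class_eq_iff word_eq_inverse)
qed


section \<open>Cayley graphs\<close>

text \<open>
  The arc \<open>(g, s)\<close> leads from \<open>g\<close> to \<open>g \<otimes> s\<close>. For inverse-closed \<open>S\<close> this is a symmetric digraph
  without parallel arcs, so its directed walks are the walks in the undirected Cayley graph.
\<close>

definition cayley_graph :: "('g, 'm) monoid_scheme \<Rightarrow> 'g set \<Rightarrow> ('g, 'g \<times> 'g) pre_digraph" where
  "cayley_graph G S =
     \<lparr>verts = carrier G, arcs = carrier G \<times> S, tail = fst, head = (\<lambda>(g, s). g \<otimes>\<^bsub>G\<^esub> s)\<rparr>"

definition loops :: "('g, 'm) monoid_scheme \<Rightarrow> 'g set \<Rightarrow> nat \<Rightarrow> ('g \<times> 'g) awalk set" where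
  "loops G S m = {p. pre_digraph.awalk (cayley_graph G S) \<one>\<^bsub>G\<^esub> p \<one>\<^bsub>G\<^esub> \<and> length p = m}"


section \<open>Thompson's group F\<close>

datatype thompson_gen = X | Y

definition thompson_relations :: "(thompson_gen word \<times> thompson_gen word) set" where
  "thompson_relations =
     (let x = (X, True); x' = (X, False); y = (Y, True); y' = (Y, False) in
       {([x, x, y, x', x'], [y, x, y, x', y']),
        ([x, x, x, y, x', x', x'], [y, x, x, y, x', x', y'])})"

definition thompson_F :: "thompson_gen word set monoid" where
  "thompson_F = presented_group thompson_relations"

definition thompson_x :: "thompson_gen word set" where
  "thompson_x = word_class thompson_relations [(X, True)]"

definition thompson_y :: "thompson_gen word set" where
  "thompson_y = word_class thompson_relations [(Y, True)]"

definition thompson_S :: "thompson_gen word set set" where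
  "thompson_S = {thompson_x, thompson_y, inv\<^bsub>thompson_F\<^esub> thompson_x, inv\<^bsub>thompson_F\<^esub> thompson_y}"

definition thompson_cogrowth :: "nat \<Rightarrow> nat" where
  "thompson_cogrowth n = card (loops thompson_F thompson_S (2 * n))"


section \<open>Loops as words\<close>

text \<open>
  The four elements of the generating set are distinct, and loops correspond to the words over it
  that represent the identity.
\<close>

lemma group_thompson_F: "group thompson_F"
  unfolding thompson_F_def by (rule group_presented_group)

definition exponent_sum :: "'a \<Rightarrow> 'a word \<Rightarrow> int" where
  "exponent_sum a w = (\<Sum>(c, b)\<leftarrow>w. if c = a then (if b then 1 else -1) else 0)"

lemma exponent_sum_thompson:
  "word_eq thompson_relations u v \<Longrightarrow> exponent_sum a u = exponent_sum a v"
  by (induction rule: word_eq.induct)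
    (auto simp: exponent_sum_def thompson_relations_def Let_def)

lemma card_thompson_S: "card thompson_S = 4"
proof -
  have "thompson_S = word_class thompson_relations `
      {[(X, True)], [(Y, True)], [(X, False)], [(Y, False)]}"
    by (simp add: thompson_S_def thompson_x_def thompson_y_def thompson_F_def
        inv_presented_group word_inverse_def)
  moreover have "inj_on (word_class thompson_relations)
      {[(X, True)], [(Y, True)], [(X, False)], [(Y, False)]}"
  proof (rule inj_onI)
    fix u v :: "thompson_gen word"
    assume uv: "u \<in> {[(X, True)], [(Y, True)], [(X, False)], [(Y, False)]}"
      "v \<in> {[(X, True)], [(Y, True)], [(X, False)], [(Y, False)]}"
    assume "word_class thompson_relations u = word_class thompson_relations v"
    hence "exponent_sum a u = exponent_sum a v" for a
      by (intro exponent_sum_thompson) (simp add: word_class_eq_iff)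
    from this[of X] this[of Y] uv show "u = v"
      by (elim insertE emptyE; simp add: exponent_sum_def)
  qed
  ultimately have "card thompson_S =
      card {[(X, True)], [(Y, True)], [(X, False)], [(Y, False)]}"
    by (metis card_image)
  thus ?thesis by simp
qed

lemma (in group) card_loops_eq_words:
  assumes "S \<subseteq> carrier G"
  shows "card (loops G S m) = card {w. set w \<subseteq> S \<and> length w = m \<and> foldr (\<otimes>) w \<one> = \<one>}"
proof -
  let ?\<Gamma> = "cayley_graph G S"
  define path where "path = rec_list (\<lambda>_. []) (\<lambda>s _ r g. (g, s) # r (g \<otimes> s))"
  have path_simps: "path [] g = []" "path (s # w) g = (g, s) # path w (g \<otimes> s)" for s w g
    by (simp_all add: path_def)
  have snd_path: "map snd (path w g) = w" for w g
    by (induction w arbitrary: g) (auto simp: path_simps)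
  have prod_closed: "foldr (\<otimes>) w \<one> \<in> carrier G" if "set w \<subseteq> S" for w
    using that assms by (induction w) auto
  have walk: "set (path w g) \<subseteq> arcs ?\<Gamma> \<and> pre_digraph.cas ?\<Gamma> g (path w g) (g \<otimes> foldr (\<otimes>) w \<one>)"
    if "set w \<subseteq> S" "g \<in> carrier G" for w g
    using that
  proof (induction w arbitrary: g)
    case Nil
    then show ?case by (simp add: path_simps pre_digraph.cas.simps)
  next
    case (Cons s w)
    hence s: "s \<in> carrier G" using assms by auto
    have eq: "g \<otimes> (s \<otimes> foldr (\<otimes>) w \<one>) = (g \<otimes> s) \<otimes> foldr (\<otimes>) w \<one>"
      using Cons.prems s prod_closed[of w] by (simp add: m_assoc)
    have IH: "set (path w (g \<otimes> s)) \<subseteq> arcs ?\<Gamma> \<and>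
        pre_digraph.cas ?\<Gamma> (g \<otimes> s) (path w (g \<otimes> s)) (g \<otimes> s \<otimes> foldr (\<otimes>) w \<one>)"
      using Cons.prems s by (intro Cons.IH) auto
    have "pre_digraph.cas ?\<Gamma> g ((g, s) # path w (g \<otimes> s)) (g \<otimes> (s \<otimes> foldr (\<otimes>) w \<one>))"
      unfolding pre_digraph.cas.simps eq using IH by (simp add: cayley_graph_def)
    with IH Cons.prems show ?case
      by (auto simp: path_simps cayley_graph_def)
  qed
  have unwalk: "set (map snd p) \<subseteq> S \<and> p = path (map snd p) g \<and> h = g \<otimes> foldr (\<otimes>) (map snd p) \<one>"
    if "set p \<subseteq> arcs ?\<Gamma>" "pre_digraph.cas ?\<Gamma> g p h" "g \<in> carrier G" for p g h
    using that
  proof (induction p arbitrary: g)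
    case Nil
    then show ?case by (simp add: path_simps pre_digraph.cas.simps)
  next
    case (Cons e p)
    obtain s where e: "e = (g, s)"
      using Cons.prems(2) by (cases e) (auto simp: pre_digraph.cas.simps cayley_graph_def)
    have s: "s \<in> S" "s \<in> carrier G" using Cons.prems assms by (auto simp: e cayley_graph_def)
    have c: "pre_digraph.cas ?\<Gamma> (g \<otimes> s) p h"
      using Cons.prems(2) unfolding pre_digraph.cas.simps by (simp add: cayley_graph_def e)
    have IH: "set (map snd p) \<subseteq> S \<and> p = path (map snd p) (g \<otimes> s) \<and>
        h = g \<otimes> s \<otimes> foldr (\<otimes>) (map snd p) \<one>"
      using Cons.prems s c by (intro Cons.IH) auto
    have "g \<otimes> s \<otimes> foldr (\<otimes>) (map snd p) \<one> = g \<otimes> (s \<otimes> foldr (\<otimes>) (map snd p) \<one>)"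
      using IH s Cons.prems prod_closed[of "map snd p"] by (simp add: m_assoc)
    with IH s show ?case by (simp add: e path_simps)
  qed
  have "bij_betw (map snd) (loops G S m)
      {w. set w \<subseteq> S \<and> length w = m \<and> foldr (\<otimes>) w \<one> = \<one>}"
  proof (rule bij_betw_byWitness[where f' = "\<lambda>w. path w \<one>"])
    have *: "set p \<subseteq> arcs ?\<Gamma>" "pre_digraph.cas ?\<Gamma> \<one> p \<one>" "length p = m" if "p \<in> loops G S m" for p
      using that by (auto simp: loops_def pre_digraph.awalk_def)
    have **: "set (map snd p) \<subseteq> S \<and> p = path (map snd p) \<one> \<and> foldr (\<otimes>) (map snd p) \<one> = \<one>"
      if "p \<in> loops G S m" for p
      using unwalk[OF *(1,2)[OF that]] prod_closed[of "map snd p"] by simp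
    show "\<forall>p\<in>loops G S m. path (map snd p) \<one> = p" using ** by metis
    show "\<forall>w\<in>{w. set w \<subseteq> S \<and> length w = m \<and> foldr (\<otimes>) w \<one> = \<one>}. map snd (path w \<one>) = w"
      by (simp add: snd_path)
    show "map snd ` loops G S m \<subseteq> {w. set w \<subseteq> S \<and> length w = m \<and> foldr (\<otimes>) w \<one> = \<one>}"
      using ** *(3) by (intro image_subsetI) (simp del: set_map)
    show "(\<lambda>w. path w \<one>) ` {w. set w \<subseteq> S \<and> length w = m \<and> foldr (\<otimes>) w \<one> = \<one>} \<subseteq> loops G S m"
    proof safe
      fix w assume w: "set w \<subseteq> S" "foldr (\<otimes>) w \<one> = \<one>" "m = length w"
      have "length (path w \<one>) = length w" using snd_path[of w \<one>] by (metis length_map)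
      with walk[of w \<one>] w show "path w \<one> \<in> loops G S (length w)"
        by (simp add: loops_def pre_digraph.awalk_def) (simp add: cayley_graph_def)
    qed
  qed
  thus ?thesis by (rule bij_betw_same_card)
qed

end

(*
  Thompson's group acts on infinite binary sequences, x by 00 -> 0, 01 -> 10, 1 -> 11 and y as a
  copy of x on the sequences starting with 1. A word that is trivial in F acts trivially, so it
  suffices to bound the number of closed walks in the group of all bijections of binary sequences.

  Let Lambda(v) be the least ratio of boundary to size (for the steps of the two-step walk) among
  the nonempty sets of at most v elements. Copies of the action inside disjoint cylinders, permuted
  by a power of x, give infinitely many commuting copies: essentially F wr Z embeds in F. A set S
  with boundary ratio much smaller than Lambda(v) is close to its translates by the first
  n ~ 1/Lambda(v) powers of the shift, hence most of its points have slices with more than v/2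
  points in most of the n directions. Subadditivity of entropy then gives
  log |S| >= (n/2) log (v/2) up to constants. Thus the exponent of log v gains a factor
  1/Lambda(v) whenever Lambda loses a constant factor; iterating d times, sets with boundary ratio
  below c_d eta have at least exp(eta^(-d)) elements. By Cheeger's argument the return probability
  decays at rate eta^2 per step until it drops below exp(-eta^(-d)), and eta = n^(-1/(d+2)) gives the
  bound exp(-c n^(d/(d+2))).
*)
theory Submission
  imports Defs "HOL-Library.Groups_Big_Fun" "HOL-Library.Cardinality" "HOL-Library.Stream"
begin

section \<open>Slices of finite sets and subadditivity of entropy\<close>

text \<open>For an equivalence relation \<open>R\<close> and a uniformly random point of
  \<open>S\<close>, the average of \<open>ln (card (slice R S x))\<close> over \<open>S\<close> is
  the conditional entropy of the point given its \<open>R\<close>-class.\<close>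

definition slice :: "('a \<Rightarrow> 'a \<Rightarrow> bool) \<Rightarrow> 'a set \<Rightarrow> 'a \<Rightarrow> 'a set" where
  "slice R S x = {y\<in>S. R x y}"

lemma finite_slice [simp]: "finite S \<Longrightarrow> finite (slice R S x)"
  by (simp add: slice_def)

lemma slice_subset: "slice R S x \<subseteq> S"
  by (auto simp: slice_def)

lemma slice_cong: "equivp R \<Longrightarrow> R x y \<Longrightarrow> slice R S x = slice R S y"
  unfolding slice_def equivp_def by metis

lemma slice_self: "equivp R \<Longrightarrow> x \<in> S \<Longrightarrow> x \<in> slice R S x"
  by (simp add: slice_def equivp_reflp)

lemma card_slice_pos: "finite S \<Longrightarrow> equivp R \<Longrightarrow> x \<in> S \<Longrightarrow> card (slice R S x) > 0"
  using slice_self[of R x S] by (auto simp: card_gt_0_iff)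

text \<open>Double counting: each \<open>y\<close> in \<open>T\<close> is seen by exactly
  \<open>card (slice R S y)\<close> points \<open>x\<close>, each giving it the reciprocal weight.
  This turns estimates class by class into global ones.\<close>

lemma sum_inverse_card_slice:
  assumes R: "equivp R" and S: "finite S" and T: "T \<subseteq> S"
  shows "(\<Sum>x\<in>S. card (slice R T x) / card (slice R S x)) = card T"
proof -
  have fT: "finite T" using S T finite_subset by auto
  have "(\<Sum>x\<in>S. card (slice R T x) / card (slice R S x)) =
      (\<Sum>x\<in>S. \<Sum>y\<in>{y\<in>T. R x y}. 1 / card (slice R S x))"
    by (simp add: slice_def)
  also have "\<dots> = (\<Sum>y\<in>T. \<Sum>x\<in>{x\<in>S. R x y}. 1 / card (slice R S x))"
    by (rule sum.swap_restrict) (use S fT in auto)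
  also have "\<dots> = (\<Sum>y\<in>T. \<Sum>x\<in>slice R S y. 1 / card (slice R S y))"
  proof (intro sum.cong HOL.refl)
    fix y
    show "{x\<in>S. R x y} = slice R S y"
      using R by (auto simp: slice_def elim: equivp_symp)
  next
    fix y x assume "x \<in> slice R S y"
    thus "1 / card (slice R S x) = 1 / card (slice R S y)"
      using slice_cong[OF R, of y x S] by (simp add: slice_def)
  qed
  also have "\<dots> = (\<Sum>y\<in>T. 1)"
  proof (rule sum.cong)
    fix y assume "y \<in> T"
    hence "card (slice R S y) > 0" using card_slice_pos[OF S R] T by blast
    thus "(\<Sum>x\<in>slice R S y. 1 / card (slice R S y)) = (1::real)" by simp
  qed simp
  finally show ?thesis by simp
qed

text \<open>Subadditivity of entropy for two independent directions inside an
  \<open>RC\<close>-class. Since \<open>ln t \<le> t - 1\<close>, it is enough that the sum of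
  \<open>?a x * ?b x / ?c x\<close> is at most \<open>card S\<close>. That sum runs over triples
  \<open>(x, y, z)\<close>, and \<open>x\<close> is recovered from the pair \<open>(y, z)\<close>,
  which lies in a single \<open>RC\<close>-class.\<close>

lemma ln_slice_join_le:
  assumes R: "equivp RA" "equivp RB" "equivp RC" and S: "finite S"
    and sub: "\<And>x y. RA x y \<Longrightarrow> RC x y" "\<And>x y. RB x y \<Longrightarrow> RC x y"
    and inter: "\<And>x y. RA x y \<Longrightarrow> RB x y \<Longrightarrow> x = y"
  shows "(\<Sum>x\<in>S. ln (card (slice RA S x))) + (\<Sum>x\<in>S. ln (card (slice RB S x)))
    \<le> (\<Sum>x\<in>S. ln (card (slice RC S x)))"
proof -
  let ?a = "\<lambda>x. real (card (slice RA S x))" and ?b = "\<lambda>x. real (card (slice RB S x))"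
    and ?c = "\<lambda>x. real (card (slice RC S x))"
  have pos: "?a x > 0" "?b x > 0" "?c x > 0" if "x \<in> S" for x
    using card_slice_pos[OF S _ that] R by simp_all
  let ?D = "SIGMA x:S. slice RA S x \<times> slice RB S x"
  have "(\<Sum>x\<in>S. ?a x * ?b x / ?c x) = (\<Sum>x\<in>S. \<Sum>p\<in>slice RA S x \<times> slice RB S x. 1 / ?c x)"
    by (simp add: card_cartesian_product)
  also have "\<dots> = (\<Sum>(x, p)\<in>?D. 1 / ?c x)"
    using S by (subst sum.Sigma) auto
  also have "\<dots> = (\<Sum>(x, p)\<in>?D. 1 / ?c (fst p))"
  proof (rule sum.cong)
    fix q assume "q \<in> ?D"
    then obtain x y z where q: "q = (x, y, z)" and "RA x y" by (auto simp: slice_def)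
    hence "slice RC S x = slice RC S y" using slice_cong R sub by metis
    thus "(case q of (x, p) \<Rightarrow> 1 / ?c x) = (case q of (x, p) \<Rightarrow> 1 / ?c (fst p))" by (simp add: q)
  qed simp
  also have "\<dots> = (\<Sum>p\<in>snd ` ?D. 1 / ?c (fst p))"
  proof (subst sum.reindex)
    have "x = x'" if "RA x y" "RA x' y" "RB x z" "RB x' z" for x x' y z
      using that inter R by (metis equivp_symp equivp_transp)
    thus "inj_on snd ?D" by (fastforce simp: inj_on_def slice_def)
  qed (auto intro!: sum.cong)
  also have "\<dots> \<le> (\<Sum>p\<in>(SIGMA y:S. slice RC S y). 1 / ?c (fst p))"
  proof (rule sum_mono2)
    have "RC y z" if "RA x y" "RB x z" for x y z
      using that sub R by (meson equivp_symp equivp_transp)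
    thus "snd ` ?D \<subseteq> (SIGMA y:S. slice RC S y)" by (fastforce simp: slice_def)
  qed (use S in auto)
  also have "\<dots> = (\<Sum>y\<in>S. \<Sum>z\<in>slice RC S y. 1 / ?c y)"
    using S by (subst sum.Sigma) (auto simp: case_prod_unfold)
  also have "\<dots> = (\<Sum>y\<in>S. 1)"
    by (rule sum.cong) (use pos in force)+
  finally have le: "(\<Sum>x\<in>S. ?a x * ?b x / ?c x) \<le> (\<Sum>y\<in>S. 1)" .
  have "(\<Sum>x\<in>S. ln (?a x) + ln (?b x) - ln (?c x)) = (\<Sum>x\<in>S. ln (?a x * ?b x / ?c x))"
    by (rule sum.cong) (use pos in \<open>auto simp: ln_mult ln_div\<close>)
  also have "\<dots> \<le> (\<Sum>x\<in>S. ?a x * ?b x / ?c x - 1)"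
    by (rule sum_mono, rule ln_le_minus_one) (use pos in simp)
  also have "\<dots> \<le> 0" using le by (simp add: sum_subtractf)
  finally show ?thesis by (simp add: sum_subtractf sum.distrib)
qed

text \<open>Induction on \<open>n\<close>: \<open>E n\<close> contains the directions
  \<open>R i\<close> with \<open>i < n\<close> and is transversal to \<open>R n\<close>.\<close>

lemma ln_slice_chain_le:
  assumes R: "\<And>i. equivp (R i)" "\<And>i. equivp (E i)" and S: "finite S"
    and sub: "\<And>i x y. R i x y \<Longrightarrow> E (Suc i) x y" "\<And>i x y. E i x y \<Longrightarrow> E (Suc i) x y"
    and inter: "\<And>i x y. R i x y \<Longrightarrow> E i x y \<Longrightarrow> x = y"
  shows "(\<Sum>i<n. \<Sum>x\<in>S. ln (card (slice (R i) S x))) \<le> (\<Sum>x\<in>S. ln (card (slice (E n) S x)))"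
proof (induction n)
  case 0
  show ?case
    using card_slice_pos[OF S R(2)[of 0]] by (auto intro!: sum_nonneg simp: Suc_le_eq)
next
  case (Suc n)
  show ?case
    using ln_slice_join_le[OF R(1)[of n] R(2)[of n] R(2)[of "Suc n"] S] sub inter Suc.IH
    by fastforce
qed

text \<open>A point rich in \<open>T\<close> but poor in \<open>S\<close> has lost at least
  \<open>V / 2\<close> members of its class to \<open>T - S\<close>, while each element of
  \<open>T - S\<close> is lost to fewer than \<open>V / 2\<close> such points, as these share one
  poor slice of \<open>S\<close>.\<close>

lemma card_small_slices_le:
  fixes V :: real
  assumes R: "equivp R" and S: "finite S" and T: "finite T" and V: "V > 0"
  shows "card {x\<in>S. card (slice R S x) < V / 2} \<le>
    card {x\<in>T. card (slice R T x) < V} + card (S - T) + card (T - S)"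
proof -
  define B where "B = {x\<in>S \<inter> T. card (slice R S x) < V / 2 \<and> card (slice R T x) \<ge> V}"
  have fB: "finite B" using S by (auto simp: B_def)
  have "real (card B) * (V / 2) = (\<Sum>x\<in>B. V / 2)" by simp
  also have "\<dots> \<le> (\<Sum>x\<in>B. real (card (slice R (T - S) x)))"
  proof (rule sum_mono)
    fix x assume x: "x \<in> B"
    have "slice R T x \<subseteq> slice R (T - S) x \<union> slice R S x" by (auto simp: slice_def)
    hence "card (slice R T x) \<le> card (slice R (T - S) x) + card (slice R S x)"
      using S T by (meson card_Un_le card_mono finite_Diff finite_UnI finite_slice le_trans)
    thus "V / 2 \<le> card (slice R (T - S) x)" using x by (simp add: B_def)
  qed
  also have "\<dots> = (\<Sum>x\<in>B. \<Sum>y\<in>{y\<in>T - S. R x y}. 1)" by (simp add: slice_def)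
  also have "\<dots> = (\<Sum>y\<in>T - S. \<Sum>x\<in>{x\<in>B. R x y}. 1)"
    by (rule sum.swap_restrict) (use T fB in auto)
  also have "\<dots> \<le> (\<Sum>y\<in>T - S. V / 2)"
  proof (rule sum_mono)
    fix y
    show "(\<Sum>x\<in>{x\<in>B. R x y}. 1) \<le> V / 2"
    proof (cases "{x\<in>B. R x y} = {}")
      case True
      show ?thesis unfolding True using V by simp
    next
      case False
      then obtain x where x: "x \<in> B" "R x y" by blast
      have "{x\<in>B. R x y} \<subseteq> slice R S x"
        using x R by (auto simp: slice_def B_def dest: equivp_symp equivp_transp)
      hence "card {x\<in>B. R x y} \<le> card (slice R S x)" using S by (simp add: card_mono)
      thus ?thesis using x by (simp add: B_def)
    qed
  qed
  also have "\<dots> = card (T - S) * (V / 2)" by simp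
  finally have B: "card B \<le> card (T - S)" using V by simp
  have "{x\<in>S. card (slice R S x) < V / 2} \<subseteq> {x\<in>T. card (slice R T x) < V} \<union> (S - T) \<union> B"
    by (auto simp: B_def)
  hence "card {x\<in>S. card (slice R S x) < V / 2} \<le>
      card ({x\<in>T. card (slice R T x) < V} \<union> (S - T) \<union> B)"
    by (rule card_mono[rotated]) (use S T fB in auto)
  also have "\<dots> \<le> card {x\<in>T. card (slice R T x) < V} + card (S - T) + card B"
    by (meson card_Un_le add_le_mono le_trans order_refl)
  finally show ?thesis using B by linarith
qed

section \<open>Boundaries, cosets and the isoperimetric gain from independent copies\<close>

text \<open>The group operation is written additively but is not commutative. Steps act on the
  right, so left translations preserve boundaries.\<close>

definition bdry :: "'g::group_add set \<Rightarrow> 'g \<Rightarrow> nat" where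
  "bdry S w = card {x\<in>S. x + w \<notin> S}"

lemma bdry_add_le:
  assumes "finite S"
  shows "bdry S (v + w) \<le> bdry S v + bdry S w"
proof -
  have "{x\<in>S. x + (v + w) \<notin> S} \<subseteq>
      {x\<in>S. x + v \<notin> S} \<union> (\<lambda>y. y - v) ` {x\<in>S. x + w \<notin> S}" (is "_ \<subseteq> ?A \<union> ?f ` ?B")
  proof
    fix x assume x: "x \<in> {x\<in>S. x + (v + w) \<notin> S}"
    show "x \<in> ?A \<union> ?f ` ?B"
    proof (cases "x + v \<in> S")
      case True
      hence "x + v \<in> ?B" using x by (simp add: add.assoc)
      thus ?thesis by (intro UnI2 image_eqI[of _ _ "x + v"]) simp_all
    qed (use x in auto)
  qed
  hence "bdry S (v + w) \<le> card (?A \<union> ?f ` ?B)"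
    unfolding bdry_def by (rule card_mono[rotated]) (use assms in auto)
  also have "\<dots> \<le> card ?A + card (?f ` ?B)" by (rule card_Un_le)
  also have "card (?f ` ?B) \<le> card ?B" by (rule card_image_le) (use assms in auto)
  finally show ?thesis by (simp add: bdry_def)
qed

text \<open>For a subgroup \<open>H\<close> the classes are the left cosets \<open>x + H\<close>,
  which are closed under right steps from \<open>H\<close>.\<close>

definition coset_rel :: "'g::group_add set \<Rightarrow> 'g \<Rightarrow> 'g \<Rightarrow> bool" where
  "coset_rel H x y \<longleftrightarrow> - x + y \<in> H"

lemma equivp_coset_rel:
  assumes "0 \<in> H" "\<And>a b. a \<in> H \<Longrightarrow> b \<in> H \<Longrightarrow> - a + b \<in> H"
  shows "equivp (coset_rel H)"
proof (rule equivpI)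
  show "reflp (coset_rel H)" using assms(1) by (auto simp: reflp_def coset_rel_def)
  have neg: "- a \<in> H" if "a \<in> H" for a using assms(2)[OF that assms(1)] by simp
  show "symp (coset_rel H)"
    using neg by (force simp: symp_def coset_rel_def minus_add)
  show "transp (coset_rel H)"
    unfolding transp_def coset_rel_def
  proof clarify
    fix x y z assume "- x + y \<in> H" "- y + z \<in> H"
    from assms(2)[OF neg[OF this(1)] this(2)] show "- x + z \<in> H"
      by (simp add: add.assoc[symmetric])
  qed
qed

text \<open>A lower bound for the isoperimetric profile. Size enters through its logarithm because
  entropy estimates add logarithms. The family \<open>s\<close> may repeat elements, and every label
  contributes to the boundary.\<close>

definition isoperimetric :: "'i set \<Rightarrow> ('i \<Rightarrow> 'g::group_add) \<Rightarrow> real \<Rightarrow> real \<Rightarrow> bool" where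
  "isoperimetric I s \<eta> L \<longleftrightarrow> (\<forall>S. finite S \<and> S \<noteq> {} \<and> ln (card S) < L \<longrightarrow>
     \<eta> * real (card S) \<le> (\<Sum>i\<in>I. real (bdry S (s i))))"

lemma hom_0:
  fixes h :: "'g::group_add \<Rightarrow> 'h::group_add"
  assumes "\<And>a b. h (a + b) = h a + h b"
  shows "h 0 = 0"
  using assms[of 0 0] by (metis add.right_neutral add_left_cancel)

lemma hom_minus:
  fixes h :: "'g::group_add \<Rightarrow> 'h::group_add"
  assumes "\<And>a b. h (a + b) = h a + h b"
  shows "h (- a) = - h a"
  using assms[of "- a" a] hom_0[of h] assms by (simp add: eq_neg_iff_add_eq_0)

lemma equivp_coset_rel_range:
  fixes h :: "'g::group_add \<Rightarrow> 'h::group_add"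
  assumes hom: "\<And>a b. h (a + b) = h a + h b"
  shows "equivp (coset_rel (range h))"
proof (rule equivp_coset_rel)
  show "0 \<in> range h" using hom_0[of h] hom by (metis rangeI)
  show "- a + b \<in> range h" if "a \<in> range h" "b \<in> range h" for a b
    using that hom hom_minus[of h] by (metis (no_types, lifting) rangeE rangeI)
qed

text \<open>On each coset of \<open>range h\<close> that holds few points of \<open>T\<close>, pull
  \<open>T\<close> back along the map from \<open>a\<close> to \<open>x + h a\<close> and apply
  \<open>iso\<close>. Weighting every point by the reciprocal of its slice size counts each coset
  once.\<close>

lemma isoperimetric_cosets:
  fixes h :: "'g::group_add \<Rightarrow> 'h::group_add"
  assumes iso: "isoperimetric I s \<eta> L"
    and hom: "\<And>a b. h (a + b) = h a + h b" and inj: "inj h" and T: "finite T"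
  shows "\<eta> * real (card {x\<in>T. ln (card (slice (coset_rel (range h)) T x)) < L}) \<le>
    (\<Sum>i\<in>I. real (bdry T (h (s i))))"
proof -
  let ?R = "coset_rel (range h)"
  let ?c = "\<lambda>x. real (card (slice ?R T x))"
  define T' where "T' = {x\<in>T. ln (?c x) < L}"
  have R: "equivp ?R" by (rule equivp_coset_rel_range) (rule hom)
  have fT': "finite T'" using T by (auto simp: T'_def)
  \<comment> \<open>Membership in \<open>T'\<close> depends on the class only, so \<open>T'\<close>
    is a union of whole slices of \<open>T\<close>.\<close>
  have slice_T': "slice ?R T' x = slice ?R T x" if "x \<in> T'" for x
  proof -
    have "y \<in> T'" if "y \<in> T" "?R x y" for y
      using that \<open>x \<in> T'\<close> slice_cong[OF R that(2), of T] by (simp add: T'_def)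
    thus ?thesis by (auto simp: slice_def T'_def)
  qed
  have main: "\<eta> \<le> (\<Sum>i\<in>I. card (slice ?R {y\<in>T'. y + h (s i) \<notin> T} x) / card (slice ?R T' x))"
    if x: "x \<in> T'" for x
  proof -
    let ?S = "{a. x + h a \<in> T}"
    have eq: "(\<lambda>a. x + h a) ` ?S = slice ?R T x"
    proof safe
      show "x + h a \<in> slice ?R T x" if "x + h a \<in> T" for a
        using that by (simp add: slice_def coset_rel_def add.assoc[symmetric])
      fix y assume y: "y \<in> slice ?R T x"
      then obtain a where "- x + y = h a" by (auto simp: slice_def coset_rel_def)
      hence "y = x + h a" by (metis add_minus_cancel)
      thus "y \<in> (\<lambda>a. x + h a) ` ?S" using y by (auto simp: slice_def)
    qed
    have inj': "inj_on (\<lambda>a. x + h a) A" for A using inj by (auto simp: inj_on_def)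
    have c: "card ?S = card (slice ?R T x)"
      using card_image[OF inj', of ?S] eq by simp
    have fS: "finite ?S"
      using finite_imageD[OF _ inj', of ?S] T eq by simp
    have "0 \<in> ?S" using x hom_0[of h] hom by (simp add: T'_def)
    hence "\<eta> * card ?S \<le> (\<Sum>i\<in>I. real (bdry ?S (s i)))"
      using iso fS c x unfolding isoperimetric_def T'_def by fastforce
    also have "\<dots> = (\<Sum>i\<in>I. real (card (slice ?R {y\<in>T'. y + h (s i) \<notin> T} x)))"
    proof (rule sum.cong)
      fix i
      have "(\<lambda>a. x + h a) ` {a\<in>?S. a + s i \<notin> ?S} = {y \<in> (\<lambda>a. x + h a) ` ?S. y + h (s i) \<notin> T}"
        by (auto simp: hom add.assoc)
      also have "\<dots> = slice ?R {y\<in>T'. y + h (s i) \<notin> T} x"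
        unfolding eq using slice_T'[OF x] by (auto simp: slice_def)
      finally show "real (bdry ?S (s i)) = card (slice ?R {y\<in>T'. y + h (s i) \<notin> T} x)"
        unfolding bdry_def using card_image[OF inj', of "{a\<in>?S. a + s i \<notin> ?S}"] by simp
    qed simp
    finally have "\<eta> * card (slice ?R T' x) \<le>
        (\<Sum>i\<in>I. real (card (slice ?R {y\<in>T'. y + h (s i) \<notin> T} x)))"
      using c slice_T'[OF x] by simp
    thus ?thesis
      using card_slice_pos[OF fT' R x] by (simp add: sum_divide_distrib[symmetric] field_simps)
  qed
  have "\<eta> * card T' = (\<Sum>x\<in>T'. \<eta>)" by simp
  also have "\<dots> \<le> (\<Sum>x\<in>T'. \<Sum>i\<in>I. card (slice ?R {y\<in>T'. y + h (s i) \<notin> T} x) / card (slice ?R T' x))"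
    by (rule sum_mono) (rule main)
  also have "\<dots> = (\<Sum>i\<in>I. real (card {y\<in>T'. y + h (s i) \<notin> T}))"
    by (subst sum.swap) (intro sum.cong HOL.refl sum_inverse_card_slice[OF R fT'], auto)
  also have "\<dots> \<le> (\<Sum>i\<in>I. real (bdry T (h (s i))))"
    unfolding bdry_def by (intro sum_mono of_nat_mono card_mono) (use T in \<open>auto simp: T'_def\<close>)
  finally show ?thesis by (simp add: T'_def)
qed

text \<open>\<open>tr i\<close> conjugates copy 0 into copy \<open>i\<close>, and \<open>H i\<close>
  contains the copies before \<open>i\<close> but meets copy \<open>i\<close> only in 0, so the
  directions are independent. If \<open>S\<close> violated the conclusion, at least half of its
  points would have rich slices in each of about \<open>1 / \<eta>\<close> directions, and adding
  entropies would make \<open>S\<close> too large.\<close>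

lemma isoperimetric_step:
  fixes s :: "'i \<Rightarrow> 'g::group_add" and j :: "nat \<Rightarrow> 'g \<Rightarrow> 'g"
    and H :: "nat \<Rightarrow> 'g set" and tr :: "nat \<Rightarrow> 'g" and C :: real
  assumes iso: "isoperimetric I s \<eta> L" and \<eta>: "0 < \<eta>" "\<eta> \<le> 1" and L: "ln 4 \<le> L" and C: "C \<ge> 2"
    and hom: "\<And>i a b. j i (a + b) = j i a + j i b" and inj: "\<And>i. inj (j i)"
    and H: "\<And>i. 0 \<in> H i" "\<And>i a b. a \<in> H i \<Longrightarrow> b \<in> H i \<Longrightarrow> - a + b \<in> H i"
      "\<And>i. range (j i) \<subseteq> H (Suc i)" "\<And>i. H i \<subseteq> H (Suc i)" "\<And>i. H i \<inter> range (j i) \<subseteq> {0}"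
    and tr: "\<And>i g. tr i + j 0 g = j i g + tr i"
    and bdry_tr: "\<And>i S. finite S \<Longrightarrow> real (bdry S (tr i)) \<le> real i * (\<Sum>k\<in>I. real (bdry S (s k)))"
    and bdry_j: "\<And>S. finite S \<Longrightarrow>
      (\<Sum>k\<in>I. real (bdry S (j 0 (s k)))) \<le> C * (\<Sum>k\<in>I. real (bdry S (s k)))"
  shows "isoperimetric I s (\<eta> / (4 * C)) (L / (8 * \<eta>))"
  unfolding isoperimetric_def
proof (intro allI impI, rule ccontr)
  fix S :: "'g set" assume S: "finite S \<and> S \<noteq> {} \<and> ln (card S) < L / (8 * \<eta>)"
  define D where "D = (\<Sum>k\<in>I. real (bdry S (s k)))"
  assume "\<not> \<eta> / (4 * C) * real (card S) \<le> (\<Sum>k\<in>I. real (bdry S (s k)))"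
  hence D: "D < \<eta> / (4 * C) * card S" by (simp add: D_def)
  have D0: "D \<ge> 0" by (simp add: D_def sum_nonneg)
  have fS: "finite S" using S by simp
  have L0: "L > 0" using L ln_gt_zero[of 4] by linarith
  \<comment> \<open>With this many directions the cost \<open>i * D\<close> of a shift stays below
    \<open>D / \<eta>\<close>, comparable to the isoperimetric error
    \<open>C * D / \<eta>\<close>.\<close>
  define n where "n = nat \<lfloor>1 / \<eta>\<rfloor>"
  have n: "n \<le> 1 / \<eta>" "1 / \<eta> \<le> 2 * real n"
  proof -
    define z where "z = 1 / \<eta>"
    have "z \<ge> 1" using \<eta> by (simp add: z_def)
    moreover from this have "\<lfloor>z\<rfloor> \<ge> 1" by (simp add: le_floor_iff)
    moreover from this have "real n = of_int \<lfloor>z\<rfloor>"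
      unfolding n_def z_def[symmetric] by (simp add: of_nat_nat)
    ultimately have "real n \<le> z" "z \<le> 2 * real n" by linarith+
    thus "n \<le> 1 / \<eta>" "1 / \<eta> \<le> 2 * real n" by (simp_all add: z_def)
  qed
  let ?R = "\<lambda>i. coset_rel (range (j i))" and ?E = "\<lambda>i. coset_rel (H i)"
  have R: "equivp (?R i)" for i by (rule equivp_coset_rel_range) (rule hom)
  have E: "equivp (?E i)" for i by (rule equivp_coset_rel) (use H in auto)
  have poor: "card {x\<in>S. card (slice (?R i) S x) < exp L / 2} \<le> card S / 2" if i: "i < n" for i
  proof -
    \<comment> \<open>Passing to this translate of \<open>S\<close> turns the boundary along copy
      \<open>i\<close> into the boundary of \<open>S\<close> along copy 0, which
      \<open>bdry_j\<close> controls for all \<open>i\<close> at once.\<close>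
    define T where "T = {y. y + tr i \<in> S}"
    have T: "(\<lambda>y. y + tr i) ` T = S"
    proof safe
      fix x assume "x \<in> S"
      thus "x \<in> (\<lambda>y. y + tr i) ` T" by (intro image_eqI[of _ _ "x - tr i"]) (auto simp: T_def)
    qed (simp add: T_def)
    have inj_tr: "inj_on (\<lambda>y. y + tr i) A" for A by (auto simp: inj_on_def)
    have fT: "finite T" using finite_imageD[OF _ inj_tr, of T] T fS by simp
    have cT: "card T = card S" using card_image[OF inj_tr, of T] T by simp
    have "S - T = {x\<in>S. x + tr i \<notin> S}" by (auto simp: T_def)
    hence ST: "card (S - T) = bdry S (tr i)" by (simp add: bdry_def)
    have TS: "card (T - S) \<le> card (S - T)"
      using card_le_sym_Diff[OF fT fS] cT by simp
    have bdry_T: "bdry T (j i g) = bdry S (j 0 g)" for g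
    proof -
      have "(\<lambda>y. y + tr i) ` {y\<in>T. y + j i g \<notin> T} = {x\<in>S. x + j 0 g \<notin> S}"
      proof safe
        fix x assume x: "x \<in> S" "x + j 0 g \<notin> S"
        have "x - tr i + j i g + tr i = x + j 0 g"
          by (simp add: add.assoc tr[symmetric]) (simp add: add.assoc[symmetric])
        with x show "x \<in> (\<lambda>y. y + tr i) ` {y\<in>T. y + j i g \<notin> T}"
          by (intro image_eqI[of _ _ "x - tr i"]) (auto simp: T_def)
      qed (auto simp: T_def add.assoc tr)
      thus ?thesis
        unfolding bdry_def using card_image[OF inj_tr, of "{y\<in>T. y + j i g \<notin> T}"] by simp
    qed
    have "\<eta> * card {x\<in>T. ln (card (slice (?R i) T x)) < L} \<le> (\<Sum>k\<in>I. real (bdry T (j i (s k))))"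
      by (rule isoperimetric_cosets[OF iso hom inj fT])
    also have "\<dots> \<le> C * D" using bdry_j[OF fS] by (simp add: bdry_T D_def)
    also have "{x\<in>T. ln (card (slice (?R i) T x)) < L} = {x\<in>T. card (slice (?R i) T x) < exp L}"
    proof (intro Collect_cong conj_cong HOL.refl)
      fix x assume "x \<in> T"
      hence "real (card (slice (?R i) T x)) > 0" using card_slice_pos[OF fT R] by simp
      thus "ln (card (slice (?R i) T x)) < L \<longleftrightarrow> card (slice (?R i) T x) < exp L"
        using ln_less_cancel_iff[of "real (card (slice (?R i) T x))" "exp L"] by simp
    qed
    finally have 1: "card {x\<in>T. card (slice (?R i) T x) < exp L} \<le> C * D / \<eta>"
      using \<eta> by (simp add: field_simps)
    have "real (card {x\<in>S. card (slice (?R i) S x) < exp L / 2}) \<le>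
        card {x\<in>T. card (slice (?R i) T x) < exp L} + card (S - T) + card (T - S)"
      using card_small_slices_le[OF R fS fT, of "exp L" i] by simp
    also have "\<dots> \<le> C * D / \<eta> + 2 * (real i * D)"
      using 1 ST TS bdry_tr[OF fS, of i] by (simp add: D_def)
    also have "\<dots> \<le> C * D / \<eta> + 2 * (1 / \<eta> * D)"
      using n i D0 by (intro add_left_mono mult_left_mono mult_right_mono) auto
    also have "\<dots> = (C + 2) / \<eta> * D" by (simp add: add_divide_distrib algebra_simps)
    also have "\<dots> \<le> (C + 2) / \<eta> * (\<eta> / (4 * C) * card S)"
      using D C \<eta> by (intro mult_left_mono) auto
    also have "\<dots> = (C + 2) / (4 * C) * card S" using \<eta> by simp
    also have "\<dots> \<le> 1 / 2 * card S"
      using C by (intro mult_right_mono) (auto simp: field_simps)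
    finally show ?thesis by simp
  qed
  have rich: "card S / 2 * (L / 2) \<le> (\<Sum>x\<in>S. ln (card (slice (?R i) S x)))" if i: "i < n" for i
  proof -
    let ?P = "{x\<in>S. card (slice (?R i) S x) < exp L / 2}"
    have "card (S - ?P) = card S - card ?P" by (intro card_Diff_subset) (use fS in auto)
    moreover have "card ?P \<le> card S" by (intro card_mono) (use fS in auto)
    ultimately have "card S / 2 \<le> card (S - ?P)" using poor[OF i] by linarith
    hence "card S / 2 * (L / 2) \<le> card (S - ?P) * (L / 2)"
      using L0 by (intro mult_right_mono) auto
    also have "\<dots> = (\<Sum>x\<in>S - ?P. L / 2)" by simp
    also have "\<dots> \<le> (\<Sum>x\<in>S - ?P. ln (card (slice (?R i) S x)))"
    proof (rule sum_mono)
      fix x assume x: "x \<in> S - ?P"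
      \<comment> \<open>A slice may lose half of its size; as \<open>L\<close> is at least
        \<open>2 * ln 2\<close>, this costs at most half of the logarithm.\<close>
      have "ln (4::real) = 2 * ln 2" using ln_realpow[of 2 2] by simp
      hence "L / 2 \<le> L - ln 2" using L by simp
      also have "\<dots> = ln (exp L / 2)" by (simp add: ln_div)
      also have "\<dots> \<le> ln (card (slice (?R i) S x))" using x by (intro ln_mono) auto
      finally show "L / 2 \<le> ln (card (slice (?R i) S x))" .
    qed
    also have "\<dots> \<le> (\<Sum>x\<in>S. ln (card (slice (?R i) S x)))"
      by (rule sum_mono2)
        (use fS card_slice_pos[OF fS R] in \<open>auto intro!: ln_ge_zero simp: Suc_le_eq\<close>)
    finally show ?thesis .
  qed
  have "n * (card S / 2 * (L / 2)) = (\<Sum>i<n. card S / 2 * (L / 2))" by simp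
  also have "\<dots> \<le> (\<Sum>i<n. \<Sum>x\<in>S. ln (card (slice (?R i) S x)))"
    by (rule sum_mono) (use rich in simp)
  also have "\<dots> \<le> (\<Sum>x\<in>S. ln (card (slice (?E n) S x)))"
  proof (rule ln_slice_chain_le[OF R E fS])
    show "?E (Suc i) x y" if "?R i x y" for i x y
      using that H(3)[of i] unfolding coset_rel_def by blast
    show "?E (Suc i) x y" if "?E i x y" for i x y
      using that H(4)[of i] unfolding coset_rel_def by blast
    show "x = y" if "?R i x y" "?E i x y" for i x y
    proof -
      have "- x + y = 0" using that H(5)[of i] unfolding coset_rel_def by blast
      thus ?thesis by (simp add: neg_eq_iff_add_eq_0[symmetric])
    qed
  qed
  also have "\<dots> \<le> (\<Sum>x\<in>S. ln (card S))"
    using card_slice_pos[OF fS E] fS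
    by (intro sum_mono ln_mono) (auto intro!: card_mono slice_subset)
  finally have "card S * (n * L / 4) \<le> card S * ln (card S)" by (simp add: field_simps)
  hence "n * L / 4 \<le> ln (card S)" using S by (simp add: card_gt_0_iff)
  \<comment> \<open>Half of the points gain \<open>L / 2\<close> in each direction, hence
    \<open>L / 4\<close> on average; \<open>n\<close> is at least
    \<open>1 / (2 * \<eta>)\<close>.\<close>
  moreover have "L / (8 * \<eta>) \<le> n * L / 4"
  proof -
    have "L / (8 * \<eta>) = 1 / \<eta> * (L / 8)" by simp
    also have "\<dots> \<le> 2 * real n * (L / 8)" using n L0 by (intro mult_right_mono) auto
    finally show ?thesis by (simp add: mult.commute)
  qed
  ultimately show False using S by simp
qed

lemma isoperimetric_mono:
  "isoperimetric I s \<eta> L \<Longrightarrow> \<eta>' \<le> \<eta> \<Longrightarrow> L' \<le> L \<Longrightarrow> isoperimetric I s \<eta>' L'"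
  unfolding isoperimetric_def
  by (meson less_le_trans mult_right_mono of_nat_0_le_iff order_trans)

section \<open>Functional form of the isoperimetric inequality\<close>

lemma Sum_any_mono:
  fixes f g :: "'a \<Rightarrow> real"
  assumes "finite {x. f x \<noteq> 0}" "finite {x. g x \<noteq> 0}" "\<And>x. f x \<le> g x"
  shows "Sum_any f \<le> Sum_any g"
proof -
  let ?A = "{x. f x \<noteq> 0} \<union> {x. g x \<noteq> 0}"
  have "finite ?A" using assms by simp
  hence "Sum_any f = sum f ?A" "Sum_any g = sum g ?A"
    by (auto intro!: Sum_any.expand_superset)
  thus ?thesis using assms(3) by (simp add: sum_mono)
qed

lemma Sum_any_translate:
  fixes f :: "'g::group_add \<Rightarrow> real"
  shows "Sum_any (\<lambda>g. f (g + a)) = Sum_any f"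
proof (rule Sum_any.reindex_cong[symmetric])
  show "bij (\<lambda>g. g + a)"
    by (rule bij_betw_byWitness[where f' = "\<lambda>g. g - a"]) auto
qed (simp add: comp_def)

lemma finite_support_translate:
  fixes f :: "'g::group_add \<Rightarrow> real"
  assumes "finite {g. f g \<noteq> 0}"
  shows "finite {g. f (g + a) \<noteq> 0}"
proof (rule finite_subset)
  show "{g. f (g + a) \<noteq> 0} \<subseteq> (\<lambda>g. g - a) ` {g. f g \<noteq> 0}"
    by (auto simp: image_iff) (metis add_diff_cancel)
qed (use assms in simp)

lemma Sum_any_sum:
  fixes f :: "'i \<Rightarrow> 'a \<Rightarrow> real"
  assumes "finite I" "\<And>i. i \<in> I \<Longrightarrow> finite {x. f i x \<noteq> 0}"
  shows "finite {x. (\<Sum>i\<in>I. f i x) \<noteq> 0} \<and> Sum_any (\<lambda>x. \<Sum>i\<in>I. f i x) = (\<Sum>i\<in>I. Sum_any (f i))"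
  using assms
proof (induction I rule: finite_induct)
  case (insert i I)
  have "{x. f i x + (\<Sum>i\<in>I. f i x) \<noteq> 0} \<subseteq> {x. f i x \<noteq> 0} \<union> {x. (\<Sum>i\<in>I. f i x) \<noteq> 0}" by auto
  moreover have "finite ({x. f i x \<noteq> 0} \<union> {x. (\<Sum>i\<in>I. f i x) \<noteq> 0})" using insert by simp
  ultimately have "finite {x. f i x + (\<Sum>i\<in>I. f i x) \<noteq> 0}" by (rule finite_subset)
  with insert show ?case by (simp add: Sum_any.distrib)
qed simp

text \<open>
  Layer-cake decomposition: \<open>F\<close> is its least positive value times the indicator function
  of its support, plus a function of smaller support, and the variations of the two parts add up.
\<close>

lemma isoperimetric_functional:
  fixes F :: "'g::group_add \<Rightarrow> real"
  assumes iso: "isoperimetric I s \<eta> L" and "0 \<le> \<eta>"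
    and "finite {g. F g \<noteq> 0}" "\<And>g. F g \<ge> 0" "F \<noteq> (\<lambda>_. 0) \<Longrightarrow> ln (card {g. F g \<noteq> 0}) < L"
  shows "\<eta> * Sum_any F \<le> (\<Sum>i\<in>I. Sum_any (\<lambda>g. \<bar>F (g + s i) - F g\<bar>))"
  using assms(3-)
proof (induction "card {g. F g \<noteq> 0}" arbitrary: F rule: less_induct)
  case less
  let ?S = "{g. F g \<noteq> 0}"
  show ?case
  proof (cases "F = (\<lambda>_. 0)")
    case True
    show ?thesis unfolding True by simp
  next
    case False
    hence S: "?S \<noteq> {}" by auto
    define m where "m = Min (F ` ?S)"
    have m_in: "m \<in> F ` ?S" unfolding m_def using S less.prems(1) by (intro Min_in) auto
    have m_le: "m \<le> F g" if "g \<in> ?S" for g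
      unfolding m_def using that less.prems(1) by (intro Min_le) auto
    obtain g0 where g0: "F g0 = m" "F g0 \<noteq> 0" using m_in by auto
    have m: "m > 0" using g0 less.prems(2)[of g0] by simp
    define A :: "'g \<Rightarrow> real" where "A = (\<lambda>g. if g \<in> ?S then 1 else 0)"
    define F' where "F' = (\<lambda>g. F g - m * A g)"
    have sub: "{g. F' g \<noteq> 0} \<subseteq> ?S" by (auto simp: F'_def A_def)
    have fin': "finite {g. F' g \<noteq> 0}" by (rule finite_subset[OF sub less.prems(1)])
    have "g0 \<notin> {g. F' g \<noteq> 0}" "g0 \<in> ?S" using g0 by (auto simp: F'_def A_def)
    hence lt: "card {g. F' g \<noteq> 0} < card ?S"
      using sub less.prems(1) by (intro psubset_card_mono) auto
    have F'0: "F' g \<ge> 0" for g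
      using m_le[of g] less.prems(2)[of g] by (auto simp: F'_def A_def)
    have small: "ln (card {g. F' g \<noteq> 0}) < L" if "F' \<noteq> (\<lambda>_. 0)"
    proof -
      have "card {g. F' g \<noteq> 0} > 0" using that fin' by (auto simp: card_gt_0_iff)
      hence "ln (card {g. F' g \<noteq> 0}) \<le> ln (card ?S)" using lt by (intro ln_mono) auto
      thus ?thesis using less.prems(3)[OF False] by simp
    qed
    have IH: "\<eta> * Sum_any F' \<le> (\<Sum>i\<in>I. Sum_any (\<lambda>g. \<bar>F' (g + s i) - F' g\<bar>))"
      by (rule less.hyps[OF lt fin']) (use F'0 small in auto)
    have "{g. A g \<noteq> 0} = ?S" by (auto simp: A_def)
    hence finA: "finite {g. A g \<noteq> 0}" using less.prems(1) by simp
    have fd: "finite {g. \<bar>f (g + a) - f g\<bar> \<noteq> 0}" if "finite {g. f g \<noteq> 0}"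
      for f :: "'g \<Rightarrow> real" and a
      by (rule finite_subset[of _ "{g. f (g + a) \<noteq> 0} \<union> {g. f g \<noteq> 0}"])
        (use that finite_support_translate[OF that, of a] in auto)
    have bd: "bdry ?S w \<le> Sum_any (\<lambda>g. \<bar>A (g + w) - A g\<bar>)" for w
    proof -
      have "real (bdry ?S w) = (\<Sum>g\<in>{g\<in>?S. g + w \<notin> ?S}. \<bar>A (g + w) - A g\<bar>)"
        unfolding bdry_def by (simp add: A_def)
      also have "\<dots> \<le> (\<Sum>g\<in>{g. \<bar>A (g + w) - A g\<bar> \<noteq> 0}. \<bar>A (g + w) - A g\<bar>)"
        by (rule sum_mono2) (use fd[OF finA, of w] in \<open>auto simp: A_def\<close>)
      finally show ?thesis by (simp add: Sum_any.expand_set)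
    qed
    \<comment> \<open>On edges that do not cross the boundary of the support \<open>A\<close> is
      constant. On crossing edges both \<open>A\<close> and \<open>F'\<close> vanish at the outer
      end and are nonnegative at the inner end, so nothing cancels.\<close>
    have "\<bar>F (g + w) - F g\<bar> = m * \<bar>A (g + w) - A g\<bar> + \<bar>F' (g + w) - F' g\<bar>" for g w
      using m F'0[of g] F'0[of "g + w"] by (auto simp: A_def F'_def)
    hence "Sum_any (\<lambda>g. \<bar>F (g + w) - F g\<bar>) =
        Sum_any (\<lambda>g. m * \<bar>A (g + w) - A g\<bar> + \<bar>F' (g + w) - F' g\<bar>)" for w
      by simp
    also have "\<dots> w = m * Sum_any (\<lambda>g. \<bar>A (g + w) - A g\<bar>) +
        Sum_any (\<lambda>g. \<bar>F' (g + w) - F' g\<bar>)" for w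
      using fd[OF finA, of w] fd[OF fin', of w] m
      by (subst Sum_any.distrib) (auto simp: Sum_any_right_distrib)
    finally have split: "Sum_any (\<lambda>g. \<bar>F (g + w) - F g\<bar>) =
        m * Sum_any (\<lambda>g. \<bar>A (g + w) - A g\<bar>) + Sum_any (\<lambda>g. \<bar>F' (g + w) - F' g\<bar>)" for w .
    have "Sum_any F = Sum_any (\<lambda>g. m * A g + F' g)" by (simp add: F'_def)
    also have "\<dots> = m * Sum_any A + Sum_any F'"
      using finA fin' m by (subst Sum_any.distrib) (auto simp: Sum_any_right_distrib)
    also have "Sum_any A = card ?S"
      using Sum_any.expand_superset[OF less.prems(1), of A] by (auto simp: A_def)
    finally have "\<eta> * Sum_any F = m * (\<eta> * card ?S) + \<eta> * Sum_any F'"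
      by (simp add: algebra_simps)
    also have "\<dots> \<le> m * (\<Sum>i\<in>I. real (bdry ?S (s i))) +
        (\<Sum>i\<in>I. Sum_any (\<lambda>g. \<bar>F' (g + s i) - F' g\<bar>))"
      using iso less.prems(1,3) S False IH m unfolding isoperimetric_def
      by (intro add_mono mult_left_mono) auto
    also have "\<dots> \<le> m * (\<Sum>i\<in>I. Sum_any (\<lambda>g. \<bar>A (g + s i) - A g\<bar>)) +
        (\<Sum>i\<in>I. Sum_any (\<lambda>g. \<bar>F' (g + s i) - F' g\<bar>))"
      using bd m by (intro add_right_mono mult_left_mono sum_mono) auto
    also have "\<dots> = (\<Sum>i\<in>I. Sum_any (\<lambda>g. \<bar>F (g + s i) - F g\<bar>))"
      by (simp add: split sum.distrib sum_distrib_left)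
    finally show ?thesis .
  qed
qed

text \<open>
  Apply the isoperimetric inequality to \<open>(f\<^sup>2 - \<tau>\<^sup>2)\<^sub>+\<close>, where \<open>\<tau>\<close> is
  half the ratio of \<open>\<Sum>f\<^sup>2\<close> to \<open>\<Sum>f\<close>: the truncation bounds the support by
  Markov's inequality and loses at most half of \<open>\<Sum>f\<^sup>2\<close>.
\<close>

lemma isoperimetric_dirichlet:
  fixes f :: "'g::group_add \<Rightarrow> real"
  assumes iso: "isoperimetric I s \<eta> L" and \<eta>: "0 < \<eta>" and I: "finite I" "I \<noteq> {}"
    and fin: "finite {g. f g \<noteq> 0}" and f0: "\<And>g. f g \<ge> 0"
    and U: "Sum_any (\<lambda>g. (f g)\<^sup>2) > 2 * exp (- L) * (Sum_any f)\<^sup>2" and f_pos: "Sum_any f > 0"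
  shows "\<eta>\<^sup>2 / (16 * card I) * Sum_any (\<lambda>g. (f g)\<^sup>2) \<le>
    (\<Sum>i\<in>I. Sum_any (\<lambda>g. (f (g + s i) - f g)\<^sup>2))"
proof -
  define U1 where "U1 = Sum_any (\<lambda>g. (f g)\<^sup>2)"
  define M where "M = Sum_any f"
  define \<tau> where "\<tau> = U1 / (2 * M)"
  define F where "F = (\<lambda>g. max 0 ((f g)\<^sup>2 - \<tau>\<^sup>2))"
  define q where "q = real (card I)"
  define E where "E = (\<Sum>i\<in>I. Sum_any (\<lambda>g. (f (g + s i) - f g)\<^sup>2))"
  have q: "q > 0" using I by (simp add: q_def card_gt_0_iff)
  have M: "M > 0" using f_pos by (simp add: M_def)
  have "0 < 2 * exp (- L) * M\<^sup>2" using M by simp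
  with U have U1: "U1 > 0" "U1 > 2 * exp (- L) * M\<^sup>2" by (simp_all add: U1_def M_def)
  hence \<tau>: "\<tau> > 0" using M by (simp add: \<tau>_def)
  have F_nz: "F g \<noteq> 0 \<longleftrightarrow> f g > \<tau>" for g
    using power_strict_mono[of \<tau> "f g" 2] power_mono[of "f g" \<tau> 2] f0[of g] \<tau>
    by (auto simp: F_def max_def not_le)
  have supp_sub: "{g. F g \<noteq> 0} \<subseteq> {g. f g \<noteq> 0}" using F_nz \<tau> by fastforce
  have finF: "finite {g. F g \<noteq> 0}" by (rule finite_subset[OF supp_sub fin])
  have fin2: "finite {g. (f g)\<^sup>2 \<noteq> 0}" using fin by simp
  have small: "ln (card {g. F g \<noteq> 0}) < L" if "F \<noteq> (\<lambda>_. 0)"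
  proof -
    have pos: "card {g. F g \<noteq> 0} > 0" using that finF by (auto simp: card_gt_0_iff)
    have "card {g. F g \<noteq> 0} * \<tau> = (\<Sum>g\<in>{g. F g \<noteq> 0}. \<tau>)" by simp
    also have "\<dots> \<le> (\<Sum>g\<in>{g. F g \<noteq> 0}. f g)" by (rule sum_mono) (use F_nz in force)
    also have "\<dots> \<le> M"
      unfolding M_def Sum_any.expand_set by (rule sum_mono2) (use fin supp_sub f0 in auto)
    finally have "card {g. F g \<noteq> 0} \<le> M / \<tau>" using \<tau> by (simp add: field_simps)
    also have "\<dots> = 2 * M\<^sup>2 / U1" by (simp add: \<tau>_def power2_eq_square)
    also have "\<dots> < exp L" using U1 by (simp add: field_simps exp_minus)
    finally show ?thesis using pos ln_less_cancel_iff[of _ "exp L"] by simp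
  qed
  have lower: "U1 / 2 \<le> Sum_any F"
  proof -
    \<comment> \<open>Pointwise \<open>F\<close> dominates
      \<open>(f g)\<^sup>2 - \<tau> * f g\<close>, whose sum is \<open>U1 / 2\<close> by the choice
      of \<open>\<tau>\<close>.\<close>
    have "U1 / 2 = U1 - \<tau> * M" using M by (simp add: \<tau>_def)
    also have "\<dots> = Sum_any (\<lambda>g. (f g)\<^sup>2 + - \<tau> * f g)"
      using fin fin2 Sum_any_right_distrib[OF fin, of "- \<tau>"] unfolding U1_def M_def
      by (subst Sum_any.distrib) auto
    also have "\<dots> \<le> Sum_any F"
    proof (rule Sum_any_mono)
      show "finite {g. (f g)\<^sup>2 + - \<tau> * f g \<noteq> 0}"
        by (rule finite_subset[OF _ fin]) auto
      fix g
      show "(f g)\<^sup>2 + - \<tau> * f g \<le> F g"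
      proof (cases "f g \<le> \<tau>")
        case True
        hence "f g * f g \<le> \<tau> * f g" using f0 by (intro mult_right_mono) auto
        thus ?thesis by (simp add: F_def power2_eq_square)
      next
        case False
        hence "\<tau> * \<tau> \<le> \<tau> * f g" using \<tau> by (intro mult_left_mono) auto
        thus ?thesis by (simp add: F_def power2_eq_square)
      qed
    qed (rule finF)
    finally show ?thesis .
  qed
  \<comment> \<open>Chosen so that the error terms \<open>2 * \<kappa> * U1\<close> add up over
    \<open>I\<close> to \<open>\<eta> * U1 / 4\<close>, half of the lower bound.\<close>
  define \<kappa> where "\<kappa> = \<eta> / (8 * q)"
  have \<kappa>: "\<kappa> > 0" using \<eta> q by (simp add: \<kappa>_def)
  have pointwise: "\<bar>F (g + w) - F g\<bar> \<le>
      1 / (2 * \<kappa>) * (f (g + w) - f g)\<^sup>2 + (\<kappa> * (f (g + w))\<^sup>2 + \<kappa> * (f g)\<^sup>2)" for g w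
  proof -
    define a b where "a = f (g + w)" and "b = f g"
    have "\<bar>F (g + w) - F g\<bar> \<le> \<bar>a\<^sup>2 - b\<^sup>2\<bar>" by (auto simp: F_def a_def b_def max_def)
    also have "\<dots> = \<bar>a - b\<bar> * \<bar>a + b\<bar>" by (simp add: abs_mult[symmetric] power2_eq_square algebra_simps)
    \<comment> \<open>Young's inequality with weight \<open>\<kappa>\<close>, from the nonnegativity
      of a square.\<close>
    also have "\<dots> \<le> 1 / (2 * \<kappa>) * (a - b)\<^sup>2 + \<kappa> / 2 * (a + b)\<^sup>2"
    proof -
      have "0 \<le> (\<bar>a - b\<bar> - \<kappa> * \<bar>a + b\<bar>)\<^sup>2 / (2 * \<kappa>)" using \<kappa> by simp
      also have "\<dots> = (\<bar>a - b\<bar>\<^sup>2 + (\<kappa> * \<bar>a + b\<bar>)\<^sup>2 - 2 * \<bar>a - b\<bar> * (\<kappa> * \<bar>a + b\<bar>)) / (2 * \<kappa>)"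
        by (simp add: power2_diff)
      also have "\<dots> = 1 / (2 * \<kappa>) * (a - b)\<^sup>2 + \<kappa> / 2 * (a + b)\<^sup>2 - \<bar>a - b\<bar> * \<bar>a + b\<bar>"
        using \<kappa> by (simp add: power_mult_distrib field_simps) (simp add: power2_eq_square)
      finally show ?thesis by simp
    qed
    also have "(a + b)\<^sup>2 \<le> 2 * a\<^sup>2 + 2 * b\<^sup>2"
      using zero_le_power2[of "a - b"] by (simp add: power2_sum power2_diff)
    finally show ?thesis using \<kappa> by (simp add: a_def b_def algebra_simps)
  qed
  have upper: "Sum_any (\<lambda>g. \<bar>F (g + w) - F g\<bar>) \<le>
      1 / (2 * \<kappa>) * Sum_any (\<lambda>g. (f (g + w) - f g)\<^sup>2) + 2 * \<kappa> * U1" for w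
  proof -
    have fin_w: "finite {g. f (g + w) \<noteq> 0}" by (rule finite_support_translate[OF fin])
    have fw: "finite ({g. f (g + w) \<noteq> 0} \<union> {g. f g \<noteq> 0})" using fin_w fin by simp
    have 1: "finite {g. (f (g + w) - f g)\<^sup>2 \<noteq> 0}" by (rule finite_subset[OF _ fw]) auto
    have 2: "finite {g. \<kappa> * (f (g + w))\<^sup>2 + \<kappa> * (f g)\<^sup>2 \<noteq> 0}" by (rule finite_subset[OF _ fw]) auto
    have "Sum_any (\<lambda>g. \<bar>F (g + w) - F g\<bar>) \<le> Sum_any (\<lambda>g.
        1 / (2 * \<kappa>) * (f (g + w) - f g)\<^sup>2 + (\<kappa> * (f (g + w))\<^sup>2 + \<kappa> * (f g)\<^sup>2))"
    proof (rule Sum_any_mono)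
      have "F g = 0" if "f g = 0" for g using that supp_sub by auto
      thus "finite {g. \<bar>F (g + w) - F g\<bar> \<noteq> 0}" by (intro finite_subset[OF _ fw]) auto
      show "finite {g. 1 / (2 * \<kappa>) * (f (g + w) - f g)\<^sup>2 + (\<kappa> * (f (g + w))\<^sup>2 + \<kappa> * (f g)\<^sup>2) \<noteq> 0}"
        by (intro finite_subset[OF _ fw]) auto
    qed (rule pointwise)
    also have "\<dots> = Sum_any (\<lambda>g. 1 / (2 * \<kappa>) * (f (g + w) - f g)\<^sup>2) +
        Sum_any (\<lambda>g. \<kappa> * (f (g + w))\<^sup>2 + \<kappa> * (f g)\<^sup>2)"
      by (rule Sum_any.distrib) (use 1 2 \<kappa> in simp_all)
    also have "Sum_any (\<lambda>g. 1 / (2 * \<kappa>) * (f (g + w) - f g)\<^sup>2) =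
        1 / (2 * \<kappa>) * Sum_any (\<lambda>g. (f (g + w) - f g)\<^sup>2)"
      by (rule Sum_any_right_distrib[OF 1, symmetric])
    also have "Sum_any (\<lambda>g. \<kappa> * (f (g + w))\<^sup>2 + \<kappa> * (f g)\<^sup>2) =
        Sum_any (\<lambda>g. \<kappa> * (f (g + w))\<^sup>2) + Sum_any (\<lambda>g. \<kappa> * (f g)\<^sup>2)"
      by (rule Sum_any.distrib) (use fin_w fin in simp_all)
    also have "Sum_any (\<lambda>g. \<kappa> * (f (g + w))\<^sup>2) = Sum_any (\<lambda>g. \<kappa> * (f g)\<^sup>2)"
      by (rule Sum_any_translate[of "\<lambda>g. \<kappa> * (f g)\<^sup>2"])
    also have "Sum_any (\<lambda>g. \<kappa> * (f g)\<^sup>2) = \<kappa> * U1"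
      unfolding U1_def by (rule Sum_any_right_distrib[OF fin2, symmetric])
    finally show ?thesis by (simp add: algebra_simps)
  qed
  have "\<eta> * (U1 / 2) \<le> \<eta> * Sum_any F" using lower \<eta> by simp
  also have "\<dots> \<le> (\<Sum>i\<in>I. Sum_any (\<lambda>g. \<bar>F (g + s i) - F g\<bar>))"
    by (rule isoperimetric_functional[OF iso]) (use \<eta> finF small in \<open>auto simp: F_def\<close>)
  also have "\<dots> \<le> (\<Sum>i\<in>I. 1 / (2 * \<kappa>) * Sum_any (\<lambda>g. (f (g + s i) - f g)\<^sup>2) + 2 * \<kappa> * U1)"
    by (rule sum_mono) (rule upper)
  also have "\<dots> = 1 / (2 * \<kappa>) * E + q * (2 * \<kappa> * U1)"
    by (simp add: sum.distrib sum_divide_distrib E_def q_def)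
  also have "q * (2 * \<kappa> * U1) = \<eta> * (U1 / 4)" using q by (simp add: \<kappa>_def)
  also have "1 / (2 * \<kappa>) * E = 4 * q / \<eta> * E" by (simp add: \<kappa>_def)
  finally have "\<eta> * (U1 / 4) \<le> 4 * q / \<eta> * E" by linarith
  hence "\<eta>\<^sup>2 / (16 * q) * U1 \<le> E"
    using \<eta> q by (simp add: field_simps power2_eq_square)
  thus ?thesis by (simp add: U1_def E_def q_def)
qed

section \<open>Counting closed walks\<close>

text \<open>Steps are labelled by letters, so letters with equal values count separately, as they do
  for words. The involution \<open>flip\<close> makes the walk operator self-adjoint.\<close>

locale symmetric_walk =
  fixes gen :: "'l::finite \<Rightarrow> 'g::group_add" and flip :: "'l \<Rightarrow> 'l"
  assumes gen_flip: "gen (flip l) = - gen l" and flip_flip [simp]: "flip (flip l) = l"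
begin

definition word_val :: "'l list \<Rightarrow> 'g" where
  "word_val u = sum_list (map gen u)"

lemma word_val_simps [simp]:
  "word_val [] = 0" "word_val (l # u) = gen l + word_val u"
  "word_val (u @ v) = word_val u + word_val v"
  by (simp_all add: word_val_def)

definition step :: "('g \<Rightarrow> real) \<Rightarrow> 'g \<Rightarrow> real" where
  "step f g = (\<Sum>l\<in>UNIV. f (g + gen l))"

text \<open>Unnormalised transition counts: \<open>walks n g\<close> counts the words of length
  \<open>n\<close> leading from \<open>g\<close> to 0.\<close>

definition walks :: "nat \<Rightarrow> 'g \<Rightarrow> real" where
  "walks n = (step ^^ n) (\<lambda>g. if g = 0 then 1 else 0)"

lemma walks_0: "walks 0 g = (if g = 0 then 1 else 0)"
  by (simp add: walks_def)

lemma walks_Suc: "walks (Suc n) = step (walks n)"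
  by (simp add: walks_def)

lemma card_words_eq_walks:
  "real (card {u. length u = n \<and> g + word_val u = 0}) = walks n g"
proof (induction n arbitrary: g)
  case 0
  have "{u. length u = 0 \<and> g + word_val u = 0} = (if g = 0 then {[]} else {})" by auto
  thus ?case by (simp add: walks_0)
next
  case (Suc n)
  let ?A = "\<lambda>n g. {u. length u = n \<and> g + word_val u = 0}"
  have fin: "finite (?A n g)" for n g
    by (rule finite_subset[OF _ finite_lists_length_eq[of UNIV n]]) auto
  have "?A (Suc n) g = (\<Union>l. (#) l ` ?A n (g + gen l))"
    by (force simp: length_Suc_conv add.assoc)
  hence "card (?A (Suc n) g) = (\<Sum>l\<in>UNIV. card ((#) l ` ?A n (g + gen l)))"
    using fin by (subst card_UN_disjoint[symmetric]) auto
  also have "\<dots> = (\<Sum>l\<in>UNIV. card (?A n (g + gen l)))"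
    by (intro sum.cong HOL.refl card_image) auto
  finally show ?case by (simp add: Suc.IH walks_Suc step_def)
qed

lemma Sum_any_step:
  fixes f :: "'g \<Rightarrow> real"
  assumes "finite {g. f g \<noteq> 0}"
  shows "finite {g. step f g \<noteq> 0}" "Sum_any (step f) = CARD('l) * Sum_any f"
  using Sum_any_sum[of UNIV "\<lambda>l g. f (g + gen l)"] finite_support_translate[OF assms]
  by (simp_all add: step_def[abs_def] Sum_any_translate)

lemma finite_walks: "finite {g. walks n g \<noteq> 0}"
  by (induction n) (auto simp: walks_0 walks_Suc Sum_any_step)

lemma Sum_any_walks: "Sum_any (walks n) = real CARD('l) ^ n"
  by (induction n) (simp_all add: walks_0 walks_Suc Sum_any_step finite_walks)

lemma walks_nonneg: "walks n g \<ge> 0"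
  using card_words_eq_walks[of n g] by (metis of_nat_0_le_iff)

text \<open>Translating the summation variable moves the step \<open>gen l\<close> to the other
  factor as its inverse; \<open>flip\<close> permutes the letters.\<close>

lemma step_adjoint:
  fixes f h :: "'g \<Rightarrow> real"
  assumes f: "finite {g. f g \<noteq> 0}" and h: "finite {g. h g \<noteq> 0}"
  shows "Sum_any (\<lambda>g. step f g * h g) = Sum_any (\<lambda>g. f g * step h g)"
proof -
  have fin1: "finite {g. f (g + gen l) * h g \<noteq> 0}" for l
    by (rule finite_subset[OF _ h]) auto
  have fin2: "finite {g. f g * h (g + gen l) \<noteq> 0}" for l
    by (rule finite_subset[OF _ f]) auto
  have "Sum_any (\<lambda>g. step f g * h g) = (\<Sum>l\<in>UNIV. Sum_any (\<lambda>g. f (g + gen l) * h g))"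
    using Sum_any_sum[of UNIV "\<lambda>l g. f (g + gen l) * h g"] fin1
    by (simp add: step_def sum_distrib_right)
  also have "\<dots> = (\<Sum>l\<in>UNIV. Sum_any (\<lambda>g. f g * h (g + gen (flip l))))"
  proof (rule sum.cong)
    fix l
    show "Sum_any (\<lambda>g. f (g + gen l) * h g) = Sum_any (\<lambda>g. f g * h (g + gen (flip l)))"
      using Sum_any_translate[of "\<lambda>g. f g * h (g + gen (flip l))" "gen l"]
      by (simp add: gen_flip add.assoc)
  qed simp
  also have "\<dots> = (\<Sum>l\<in>UNIV. Sum_any (\<lambda>g. f g * h (g + gen l)))"
    by (rule sum.reindex_bij_witness[of _ flip flip]) auto
  also have "\<dots> = Sum_any (\<lambda>g. f g * step h g)"
    using Sum_any_sum[of UNIV "\<lambda>l g. f g * h (g + gen l)"] fin2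
    by (simp add: step_def sum_distrib_left)
  finally show ?thesis .
qed

text \<open>Self-adjointness moves the steps one by one from the first factor to the second.\<close>

lemma walks_add: "Sum_any (\<lambda>g. walks m g * walks n g) = walks (m + n) 0"
proof (induction m arbitrary: n)
  case 0
  have "Sum_any (\<lambda>g. walks 0 g * walks n g) = Sum_any (\<lambda>g. if g = 0 then walks n g else 0)"
    by (rule Sum_any.cong) (simp add: walks_0)
  thus ?case by simp
next
  case (Suc m)
  show ?case
    using step_adjoint[OF finite_walks finite_walks, of m n] Suc[of "Suc n"]
    by (simp add: walks_Suc)
qed

lemma walks_double: "Sum_any (\<lambda>g. (walks n g)\<^sup>2) = walks (2 * n) 0"
  using walks_add[of n n] by (simp add: power2_eq_square mult_2)

definition two_steps :: "'l \<times> 'l \<Rightarrow> 'g" where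
  "two_steps = (\<lambda>(l, m). gen l + gen m)"

text \<open>Expanding the squares leaves the quadratic form of \<open>step\<close> applied twice,
  which self-adjointness turns into the squared norm of \<open>step f\<close>. The two-step form
  thus measures the norm lost in one step, even for a periodic walk.\<close>

lemma dirichlet_two_steps:
  fixes f :: "'g \<Rightarrow> real"
  assumes f: "finite {g. f g \<noteq> 0}"
  shows "(\<Sum>p\<in>UNIV. Sum_any (\<lambda>g. (f (g + two_steps p) - f g)\<^sup>2)) =
    2 * (real CARD('l))\<^sup>2 * Sum_any (\<lambda>g. (f g)\<^sup>2) - 2 * Sum_any (\<lambda>g. (step f g)\<^sup>2)"
proof -
  define N where "N = Sum_any (\<lambda>g. (f g)\<^sup>2)"
  have f2: "finite {g. (f g)\<^sup>2 \<noteq> 0}" using f by simp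
  have fm: "finite {g. f (g + w) * f g \<noteq> 0}" for w by (rule finite_subset[OF _ f]) auto
  have "Sum_any (\<lambda>g. (f (g + w) - f g)\<^sup>2) = 2 * N - 2 * Sum_any (\<lambda>g. f (g + w) * f g)" for w
  proof -
    have fw: "finite {g. (f (g + w))\<^sup>2 \<noteq> 0}"
      using finite_support_translate[OF f, of w] by simp
    have "Sum_any (\<lambda>g. (f (g + w) - f g)\<^sup>2) =
        Sum_any (\<lambda>g. ((f (g + w))\<^sup>2 + (f g)\<^sup>2) + - 2 * (f (g + w) * f g))"
      by (simp add: power2_diff algebra_simps)
    also have "\<dots> = Sum_any (\<lambda>g. (f (g + w))\<^sup>2 + (f g)\<^sup>2) + Sum_any (\<lambda>g. - 2 * (f (g + w) * f g))"
    proof (rule Sum_any.distrib)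
      show "finite {g. (f (g + w))\<^sup>2 + (f g)\<^sup>2 \<noteq> 0}"
        by (rule finite_subset[of _ "{g. (f (g + w))\<^sup>2 \<noteq> 0} \<union> {g. (f g)\<^sup>2 \<noteq> 0}"]) (use fw f2 in auto)
    qed (use fm in simp)
    also have "Sum_any (\<lambda>g. - 2 * (f (g + w) * f g)) = - 2 * Sum_any (\<lambda>g. f (g + w) * f g)"
      by (rule Sum_any_right_distrib[OF fm, symmetric])
    also have "Sum_any (\<lambda>g. (f (g + w))\<^sup>2 + (f g)\<^sup>2) = Sum_any (\<lambda>g. (f (g + w))\<^sup>2) + N"
      unfolding N_def by (rule Sum_any.distrib[OF fw f2])
    also have "Sum_any (\<lambda>g. (f (g + w))\<^sup>2) = N"
      unfolding N_def by (rule Sum_any_translate[of "\<lambda>g. (f g)\<^sup>2"])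
    finally show ?thesis by simp
  qed
  hence "(\<Sum>p\<in>UNIV. Sum_any (\<lambda>g. (f (g + two_steps p) - f g)\<^sup>2)) =
      2 * (real CARD('l))\<^sup>2 * N -
      2 * (\<Sum>p\<in>UNIV. Sum_any (\<lambda>g. f (g + two_steps p) * f g))"
    by (simp add: sum_subtractf sum_distrib_left power2_eq_square)
  also have "(\<Sum>p\<in>UNIV. Sum_any (\<lambda>g. f (g + two_steps p) * f g)) =
      Sum_any (\<lambda>g. step (step f) g * f g)"
  proof -
    have "step (step f) g * f g = (\<Sum>p\<in>UNIV. f (g + two_steps p) * f g)" for g
      by (simp add: step_def two_steps_def sum.cartesian_product sum_distrib_right
          add.assoc case_prod_unfold)
    thus ?thesis using Sum_any_sum[of UNIV "\<lambda>p g. f (g + two_steps p) * f g"] fm by simp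
  qed
  also have "\<dots> = Sum_any (\<lambda>g. (step f g)\<^sup>2)"
    using step_adjoint[OF Sum_any_step(1)[OF f] f] by (simp add: power2_eq_square)
  finally show ?thesis by (simp add: N_def)
qed

text \<open>The normalised squared norm never increases. If it is above the threshold at time
  \<open>n + 1\<close>, it was so at time \<open>n\<close>, and there the Dirichlet inequality
  forces a contraction. The constant is \<open>16 * q\<^sup>2\<close> for the
  \<open>q\<^sup>2\<close> labels, times 2 from the Dirichlet identity, times
  \<open>q\<^sup>2\<close> from normalising one step.\<close>

lemma walks_dichotomy:
  assumes iso: "isoperimetric UNIV two_steps \<eta> L" and \<eta>: "0 < \<eta>"
  defines "q \<equiv> real CARD('l)"
  shows "walks (2 * n) 0 \<le> 2 * exp (- L) * q ^ (2 * n) \<or>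
    walks (2 * n) 0 \<le> q ^ (2 * n) * (1 - \<eta>\<^sup>2 / (32 * q ^ 4)) ^ n"
proof (induction n)
  case 0
  show ?case by (simp add: walks_0)
next
  case (Suc n)
  let ?U = "\<lambda>n. Sum_any (\<lambda>g. (walks n g)\<^sup>2)"
  define c where "c = 1 - \<eta>\<^sup>2 / (32 * q ^ 4)"
  have q: "q > 0" by (simp add: q_def)
  have E: "(\<Sum>p\<in>UNIV. Sum_any (\<lambda>g. (walks n (g + two_steps p) - walks n g)\<^sup>2)) =
      2 * q\<^sup>2 * ?U n - 2 * ?U (Suc n)" (is "?E = _")
    using dirichlet_two_steps[OF finite_walks[of n]] by (simp add: walks_Suc q_def)
  have E0: "?E \<ge> 0"
    by (intro sum_nonneg) (simp add: Sum_any.expand_set sum_nonneg)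
  show ?case
  proof (cases "?U (Suc n) \<le> 2 * exp (- L) * q ^ (2 * Suc n)")
    case False
    moreover have "2 * exp (- L) * q ^ (2 * Suc n) = 2 * exp (- L) * q ^ (2 * n) * q\<^sup>2"
      by (simp add: power2_eq_square)
    ultimately have "2 * exp (- L) * q ^ (2 * n) * q\<^sup>2 < q\<^sup>2 * ?U n"
      using E E0 by linarith
    hence big: "2 * exp (- L) * q ^ (2 * n) < ?U n"
      using q by (simp add: mult.commute)
    hence Ub: "?U n \<le> q ^ (2 * n) * c ^ n"
      using Suc.IH by (auto simp: walks_double c_def)
    have "0 < 2 * exp (- L) * q ^ (2 * n)" using q by simp
    with big have Un: "?U n > 0" by linarith
    have "\<eta>\<^sup>2 / (16 * CARD('l \<times> 'l)) * ?U n \<le> ?E"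
      by (rule isoperimetric_dirichlet[OF iso \<eta>])
        (use big q in \<open>simp_all add: finite_walks walks_nonneg Sum_any_walks
            power_mult[symmetric] mult.commute[of n] flip: q_def\<close>)
    hence "\<eta>\<^sup>2 / (16 * q\<^sup>2) * ?U n \<le> 2 * q\<^sup>2 * ?U n - 2 * ?U (Suc n)"
      unfolding E by (simp add: q_def power2_eq_square)
    moreover have "q\<^sup>2 * c * ?U n = q\<^sup>2 * ?U n - \<eta>\<^sup>2 / (32 * q\<^sup>2) * ?U n"
      using q by (simp add: c_def field_simps power_numeral_reduce power2_eq_square)
    ultimately have dec: "?U (Suc n) \<le> q\<^sup>2 * c * ?U n" by simp
    \<comment> \<open>Multiplying the induction hypothesis by \<open>c\<close> requires this; it
      follows from \<open>dec\<close>, whose left side is nonnegative.\<close>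
    have "c \<ge> 0"
    proof -
      have "0 \<le> ?U (Suc n)" by (simp add: Sum_any.expand_set sum_nonneg)
      hence "0 \<le> q\<^sup>2 * c * ?U n" using dec by linarith
      thus ?thesis using Un q by (simp add: zero_le_mult_iff)
    qed
    hence "?U (Suc n) \<le> q\<^sup>2 * c * (q ^ (2 * n) * c ^ n)"
      using dec mult_left_mono[OF Ub, of "q\<^sup>2 * c"] by simp
    also have "\<dots> = q ^ (2 * Suc n) * c ^ Suc n" by (simp add: power2_eq_square)
    finally show ?thesis unfolding walks_double c_def by blast
  qed (simp only: walks_double simp_thms)
qed

end

section \<open>The action of Thompson's group on binary sequences\<close>

text \<open>A type of its own lets composition be the addition of \<open>group_add\<close>;
  \<open>p + q\<close> applies \<open>q\<close> first.\<close>

typedef 'a bijection = "{f :: 'a \<Rightarrow> 'a. bij f}"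
  morphisms app Abs_bijection
  by (rule exI[of _ id]) simp

setup_lifting type_definition_bijection

lemma bij_app [simp]: "bij (app p)"
  using app[of p] by simp

instantiation bijection :: (type) group_add
begin

lift_definition zero_bijection :: "'a bijection" is id by simp
lift_definition plus_bijection :: "'a bijection \<Rightarrow> 'a bijection \<Rightarrow> 'a bijection" is "(\<circ>)"
  by (rule bij_comp)
lift_definition uminus_bijection :: "'a bijection \<Rightarrow> 'a bijection" is "inv_into UNIV"
  by (rule bij_imp_bij_inv)
definition minus_bijection :: "'a bijection \<Rightarrow> 'a bijection \<Rightarrow> 'a bijection" where
  "minus_bijection p q = p + - q"

instance
proof
  fix a b c :: "'a bijection"
  show "a + b + c = a + (b + c)" by transfer (simp add: comp_assoc)
  show "0 + a = a" by transfer simp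
  show "a + 0 = a" by transfer simp
  show "- a + a = 0" by transfer (simp add: bij_is_inj)
  show "a + - b = a - b" by (simp add: minus_bijection_def)
qed

end

lemma app_zero [simp]: "app 0 s = s"
  by (simp add: zero_bijection.rep_eq)

lemma app_plus [simp]: "app (p + q) s = app p (app q s)"
  by (simp add: plus_bijection.rep_eq)

lemma app_uminus_iff: "app (- p) s = t \<longleftrightarrow> s = app p t"
  by (simp add: uminus_bijection.rep_eq) (metis bij_app bij_inv_eq_iff)

lemma bijection_eqI: "(\<And>s. app p s = app q s) \<Longrightarrow> p = q"
  by (metis app_inject ext)

fun prepend_map :: "bool \<Rightarrow> (bool stream \<Rightarrow> bool stream) \<Rightarrow> bool stream \<Rightarrow> bool stream" where
  "prepend_map c f (a ## s) = a ## (if a = c then f s else s)"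

lemma bij_prepend_map:
  assumes "bij f"
  shows "bij (prepend_map c f)"
proof (rule bij_betw_byWitness[where f' = "prepend_map c (inv_into UNIV f)"])
  have "prepend_map c (inv_into UNIV f) (prepend_map c f s) = s" for s
    using assms by (cases s) (simp add: bij_is_inj)
  moreover have "prepend_map c f (prepend_map c (inv_into UNIV f) s) = s" for s
    using assms by (cases s) (simp add: bij_is_surj surj_f_inv_f)
  ultimately show "\<forall>s\<in>UNIV. prepend_map c (inv_into UNIV f) (prepend_map c f s) = s"
    "\<forall>s\<in>UNIV. prepend_map c f (prepend_map c (inv_into UNIV f) s) = s" by auto
qed auto

text \<open>Embeds the group into the bijections supported on the cylinder of sequences starting
  with \<open>c\<close>.\<close>

lift_definition zoom :: "bool \<Rightarrow> bool stream bijection \<Rightarrow> bool stream bijection" is prepend_map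
  by (rule bij_prepend_map)

lemma app_zoom [simp]: "app (zoom c p) (a ## s) = a ## (if a = c then app p s else s)"
  by (simp add: zoom.rep_eq)

lemma zoom_add: "zoom c (p + q) = zoom c p + zoom c q"
proof (rule bijection_eqI)
  fix s show "app (zoom c (p + q)) s = app (zoom c p + zoom c q) s" by (cases s) simp
qed

lemma inj_zoom: "inj (zoom c)"
proof (rule injI, rule bijection_eqI)
  fix p q s assume "zoom c p = zoom c q"
  hence "app (zoom c p) (c ## s) = app (zoom c q) (c ## s)" by simp
  thus "app p s = app q s" by simp
qed

lemma zoom_uminus: "zoom c (- p) = - zoom c p"
  by (rule hom_minus) (rule zoom_add)

fun rotation_map :: "bool stream \<Rightarrow> bool stream" where
  "rotation_map (a ## b ## s) =
     (if a then True ## True ## b ## s else if b then True ## False ## s else False ## s)"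

fun inv_rotation_map :: "bool stream \<Rightarrow> bool stream" where
  "inv_rotation_map (a ## b ## s) =
     (if \<not> a then False ## False ## b ## s else if b then True ## s else False ## True ## s)"

lemma stream_cases2: obtains a b s where "t = a ## b ## s"
  by (metis stream.exhaust_sel)

lemma stream_cases3: obtains a b c s where "t = a ## b ## c ## s"
  by (metis stream.exhaust_sel)

lift_definition tree_rotation :: "bool stream bijection" is rotation_map
proof (rule bij_betw_byWitness[where f' = inv_rotation_map])
  show "\<forall>t\<in>UNIV. inv_rotation_map (rotation_map t) = t"
  proof
    fix t :: "bool stream"
    show "inv_rotation_map (rotation_map t) = t" by (cases t rule: stream_cases3) simp
  qed
  show "\<forall>t\<in>UNIV. rotation_map (inv_rotation_map t) = t"
  proof
    fix t :: "bool stream"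
    show "rotation_map (inv_rotation_map t) = t" by (cases t rule: stream_cases3) simp
  qed
qed auto

lemma app_tree_rotation [simp]:
  "app tree_rotation (a ## b ## s) =
     (if a then True ## True ## b ## s else if b then True ## False ## s else False ## s)"
  by (simp add: tree_rotation.rep_eq)

text \<open>The rotation carries the cylinder of 1 onto that of 11 by changing the prefix
  alone.\<close>

lemma tree_rotation_zoom_True:
  "tree_rotation + zoom True p = zoom True (zoom True p) + tree_rotation"
proof (rule bijection_eqI)
  fix t :: "bool stream"
  obtain a b s where t: "t = a ## b ## s" by (rule stream_cases2)
  obtain a' b' s' where t': "app p (b ## s) = a' ## b' ## s'" by (rule stream_cases2)
  show "app (tree_rotation + zoom True p) t = app (zoom True (zoom True p) + tree_rotation) t"
    by (simp add: t t')
qed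

lemma tree_rotation_zoom_False_True:
  "tree_rotation + zoom False (zoom True p) = zoom True (zoom False p) + tree_rotation"
proof (rule bijection_eqI)
  fix t :: "bool stream"
  obtain a b s where t: "t = a ## b ## s" by (rule stream_cases2)
  show "app (tree_rotation + zoom False (zoom True p)) t =
      app (zoom True (zoom False p) + tree_rotation) t"
    by (simp add: t)
qed

text \<open>The pentagon relation: two rotations at the root equal three rotations along the other
  side of the pentagon of binary trees.\<close>

lemma tree_rotation_pentagon:
  "tree_rotation + tree_rotation =
    zoom True tree_rotation + (tree_rotation + zoom False tree_rotation)"
proof (rule bijection_eqI)
  fix t :: "bool stream"
  obtain a b c s where t: "t = a ## b ## c ## s" by (rule stream_cases3)
  show "app (tree_rotation + tree_rotation) t =
      app (zoom True tree_rotation + (tree_rotation + zoom False tree_rotation)) t"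
    by (simp add: t)
qed

lemma tree_rotation_nonzero: "tree_rotation \<noteq> 0"
proof
  assume "tree_rotation = 0"
  hence "app tree_rotation (False ## True ## sconst True) = app 0 (False ## True ## sconst True)" by simp
  thus False by simp
qed

section \<open>Thompson's relations among bijections of binary sequences\<close>

primrec letter_val :: "thompson_gen \<Rightarrow> bool stream bijection" where
  "letter_val X = tree_rotation"
| "letter_val Y = zoom True tree_rotation"

lemma UNIV_thompson_gen: "(UNIV :: thompson_gen set) = {X, Y}"
  using thompson_gen.exhaust by auto

instance thompson_gen :: finite
  by standard (simp add: UNIV_thompson_gen)

lemma card_letters: "CARD(thompson_gen \<times> bool) = 4"
  by (simp add: UNIV_thompson_gen)

interpretation thompson: symmetric_walk
  "\<lambda>(a, b). if b then letter_val a else - letter_val a" "\<lambda>(a, b). (a, \<not> b)"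
  by unfold_locales auto

lemma conj_tree_rotation: "tree_rotation + (zoom True p + - tree_rotation) = zoom True (zoom True p)"
  using tree_rotation_zoom_True[of p] by (metis add.assoc add.right_neutral add.right_inverse)

lemma conj_zoom_tree_rotation:
  "zoom True tree_rotation + (zoom True (zoom True p) + - zoom True tree_rotation) =
    zoom True (zoom True (zoom True p))"
  using conj_tree_rotation[of p] by (metis zoom_add zoom_uminus)

text \<open>Conjugation by \<open>x\<close> pushes \<open>zoom True p\<close> one level deeper, and
  conjugation by \<open>y\<close> does so from the second level on. Both sides of the first relation
  become the rotation at depth 3, those of the second at depth 4.\<close>

lemma word_val_eq:
  assumes "word_eq thompson_relations u v"
  shows "thompson.word_val u = thompson.word_val v"
  using assms
proof induction
  case (relation u v)
  let ?x = tree_rotation and ?z = "zoom True"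
  have conj: "?x + (?z p + (- ?x + q)) = ?z (?z p) + q" for p q
    using conj_tree_rotation[of p] by (metis add.assoc)
  have conj': "?z ?x + (?z (?z p) + (- ?z ?x + q)) = ?z (?z (?z p)) + q" for p q
    using conj_zoom_tree_rotation[of p] by (metis add.assoc)
  have c1: "?x + (?x + (?z p + (- ?x + (- ?x + q)))) = ?z (?z (?z p)) + q" for p q
    using conj[of p "- ?x + q"] conj[of "?z p" q] by (simp add: add.assoc)
  have c2: "?x + (?x + (?x + (?z p + (- ?x + (- ?x + (- ?x + q)))))) = ?z (?z (?z (?z p))) + q"
    for p q
    using c1[of p "- ?x + q"] conj[of "?z (?z p)" q] by (simp add: add.assoc)
  have uv: "(u, v) = ([(X, True), (X, True), (Y, True), (X, False), (X, False)],
        [(Y, True), (X, True), (Y, True), (X, False), (Y, False)]) \<or>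
      (u, v) = ([(X, True), (X, True), (X, True), (Y, True), (X, False), (X, False), (X, False)],
        [(Y, True), (X, True), (X, True), (Y, True), (X, False), (X, False), (Y, False)])"
    using relation by (simp add: thompson_relations_def Let_def)
  \<comment> \<open>The trailing 0 is the value of the empty word that ends the evaluation of
    \<open>word_val\<close>.\<close>
  have "?x + (?x + (?z ?x + (- ?x + (- ?x + 0)))) = ?z ?x + (?x + (?z ?x + (- ?x + (- ?z ?x + 0))))"
    unfolding c1 conj conj' ..
  moreover have "?x + (?x + (?x + (?z ?x + (- ?x + (- ?x + (- ?x + 0)))))) =
      ?z ?x + (?x + (?x + (?z ?x + (- ?x + (- ?x + (- ?z ?x + 0))))))"
    unfolding c2 unfolding c1 conj' ..
  ultimately show ?case using uv by (elim disjE) (simp_all only: prod.inject thompson.word_val_simps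
    letter_val.simps prod.case if_True if_False)
qed auto

section \<open>Boundaries along even words, and independent copies of the action\<close>

lemma (in symmetric_walk) bdry_word_val_le:
  assumes S: "finite S"
  shows "even (length u) \<Longrightarrow>
    real (bdry S (word_val u)) \<le> real (length u div 2) * (\<Sum>p\<in>UNIV. real (bdry S (two_steps p)))"
proof (induction u rule: induct_list012)
  case 1
  show ?case by (simp add: bdry_def)
next
  case (3 a b u)
  have "word_val (a # b # u) = two_steps (a, b) + word_val u"
    by (simp add: two_steps_def add.assoc)
  hence "real (bdry S (word_val (a # b # u))) \<le>
      real (bdry S (two_steps (a, b))) + real (bdry S (word_val u))"
    using bdry_add_le[OF S, of "two_steps (a, b)" "word_val u"] by simp
  moreover have "real (bdry S (two_steps (a, b))) \<le> (\<Sum>p\<in>UNIV. real (bdry S (two_steps p)))"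
    by (rule member_le_sum) auto
  ultimately show ?case using "3.IH"(1) "3.prems" by (simp add: algebra_simps)
qed simp

text \<open>
  Only even powers of the generator \<open>x\<close> serve as shifts, since the two-step walk controls
  the even words alone. Each copy fixes all later addresses, which makes the copies independent.
\<close>

definition copy :: "nat \<Rightarrow> bool stream bijection \<Rightarrow> bool stream bijection" where
  "copy i p = (zoom True ^^ Suc (2 * i)) (zoom False p)"

primrec shift :: "nat \<Rightarrow> bool stream bijection" where
  "shift 0 = 0"
| "shift (Suc i) = (tree_rotation + tree_rotation) + shift i"

definition address :: "nat \<Rightarrow> bool stream \<Rightarrow> bool stream" where
  "address i s = replicate (Suc (2 * i)) True @- False ## s"

text \<open>Serves as \<open>H\<close> in \<open>isoperimetric_step\<close>: copies of index below
  \<open>k\<close> lie in it, while copy \<open>k\<close> meets it only in 0.\<close>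

definition fixes_from :: "nat \<Rightarrow> bool stream bijection set" where
  "fixes_from k = {p. \<forall>i\<ge>k. \<forall>s. app p (address i s) = address i s}"

lemma zoom_power_add: "(zoom c ^^ m) (p + q) = (zoom c ^^ m) p + (zoom c ^^ m) q"
  by (induction m) (simp_all add: zoom_add)

lemma copy_add: "copy i (p + q) = copy i p + copy i q"
  by (simp add: copy_def zoom_add zoom_power_add)

lemma inj_copy: "inj (copy i)"
proof -
  have "inj (zoom True ^^ Suc (2 * i))" by (rule inj_fn[OF inj_zoom])
  hence "inj ((zoom True ^^ Suc (2 * i)) \<circ> zoom False)" by (rule inj_compose[OF _ inj_zoom])
  thus ?thesis by (simp add: copy_def[abs_def] comp_def)
qed

lemma app_zoom_power: "app ((zoom c ^^ m) p) (replicate m c @- s) = replicate m c @- app p s"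
  by (induction m) simp_all

lemma app_copy_same: "app (copy i p) (address i s) = address i (app p s)"
  unfolding copy_def address_def by (subst app_zoom_power) simp

text \<open>After \<open>2 * i + 1\<close> digits 1 the later address has another 1 where the
  cylinder of copy \<open>i\<close> has a 0.\<close>

lemma app_copy_greater:
  assumes "i < k"
  shows "app (copy i p) (address k s) = address k s"
proof -
  have "Suc (2 * k) = Suc (2 * i) + Suc (2 * (k - i) - 1)" using assms by simp
  hence "replicate (Suc (2 * k)) True =
      replicate (Suc (2 * i)) True @ replicate (Suc (2 * (k - i) - 1)) True"
    by (simp only: replicate_add)
  hence "address k s = replicate (Suc (2 * i)) True @-
      (True ## replicate (2 * (k - i) - 1) True @- False ## s)"
    by (simp add: address_def del: replicate.simps(2)) (simp add: replicate.simps(2))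
  thus ?thesis unfolding copy_def by (simp only: app_zoom_power) simp
qed

lemma range_copy_fixes: "range (copy i) \<subseteq> fixes_from (Suc i)"
  by (auto simp: fixes_from_def app_copy_greater)

lemma fixes_from_mono: "i \<le> k \<Longrightarrow> fixes_from i \<subseteq> fixes_from k"
  by (auto simp: fixes_from_def)

lemma fixes_from_copy:
  assumes "copy i p \<in> fixes_from i"
  shows "copy i p = 0"
proof -
  have "address i (app p s) = address i s" for s
    using assms app_copy_same[of i p s] unfolding fixes_from_def by auto
  hence "p = 0" by (intro bijection_eqI) (simp add: address_def)
  thus ?thesis using hom_0[of "copy i"] copy_add by simp
qed

lemma fixes_from_subgroup: "p \<in> fixes_from k \<Longrightarrow> q \<in> fixes_from k \<Longrightarrow> - p + q \<in> fixes_from k"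
  by (auto simp: fixes_from_def app_uminus_iff)

lemma tree_rotation_copy:
  "tree_rotation + tree_rotation + copy i p = copy (Suc i) p + (tree_rotation + tree_rotation)"
  using tree_rotation_zoom_True by (simp add: copy_def add.assoc) (simp add: add.assoc[symmetric])

lemma shift_copy: "shift i + copy 0 p = copy i p + shift i"
proof (induction i)
  case (Suc i)
  show ?case
    using Suc tree_rotation_copy[of i p] by simp (metis add.assoc)
qed simp

lemma shift_add_shift_Suc: "s + shift (Suc i) = (s + (tree_rotation + tree_rotation)) + shift i"
  by (simp add: add.assoc)

text \<open>Equal shifts would conjugate copy 0 to two different copies, which meet only in
  0.\<close>

lemma inj_shift: "inj shift"
proof -
  have False if "shift i = shift k" "i < k" for i k
  proof -
    have "copy i tree_rotation = copy k tree_rotation"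
      using shift_copy[of i tree_rotation] shift_copy[of k tree_rotation] that(1)
      by (metis add_right_cancel)
    moreover have "copy i tree_rotation \<in> fixes_from (Suc i)" using range_copy_fixes by blast
    moreover have "fixes_from (Suc i) \<subseteq> fixes_from k" using that(2) by (intro fixes_from_mono) simp
    ultimately have "copy k tree_rotation \<in> fixes_from k" by auto
    hence "copy k tree_rotation = copy k 0"
      using fixes_from_copy hom_0[of "copy k"] copy_add by simp
    thus False using inj_copy tree_rotation_nonzero by (auto dest: injD)
  qed
  thus ?thesis by (metis injI linorder_neqE_nat)
qed

abbreviation letter_elem :: "thompson_gen \<times> bool \<Rightarrow> bool stream bijection" where
  "letter_elem \<equiv> \<lambda>(a, b). if b then letter_val a else - letter_val a"

text \<open>The pentagon relation inside the cylinder of 1, solved for its last rotation, with the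
  inverse rotation at depth 2 written as \<open>x\<close> times the inverse of \<open>y\<close>
  times the inverse of \<open>x\<close>.\<close>

definition copy_X :: "thompson_gen word" where
  "copy_X = [(Y, False), (X, True), (Y, False), (X, False), (Y, True), (Y, True)]"

text \<open>Conjugating \<open>copy_X\<close> by \<open>x\<close> moves it from cylinder 10 to 110;
  conjugating back by \<open>y\<close> brings it to 101.\<close>

definition copy_Y :: "thompson_gen word" where
  "copy_Y = [(Y, False), (X, True)] @ copy_X @ [(X, False), (Y, True)]"

primrec copy_word :: "thompson_gen \<Rightarrow> thompson_gen word" where
  "copy_word X = copy_X"
| "copy_word Y = copy_Y"

lemma word_val_copy_X: "thompson.word_val copy_X = copy 0 tree_rotation"
proof -
  let ?x = tree_rotation and ?y = "zoom True tree_rotation"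
  have "?y + ?y = zoom True ?y + (?y + copy 0 ?x)"
    using arg_cong[OF tree_rotation_pentagon, of "zoom True"] by (simp add: zoom_add copy_def)
  hence "copy 0 ?x = - ?y + (- zoom True ?y + (?y + ?y))"
    by (metis minus_add_cancel)
  also have "- zoom True ?y = ?x + (- ?y + - ?x)"
    using conj_tree_rotation[of ?x] by (metis minus_add minus_minus add.assoc)
  finally show ?thesis
    by (simp only: copy_X_def thompson.word_val_simps letter_val.simps prod.case if_True if_False
        add.assoc add_0_right)
qed

lemma word_val_copy_Y: "thompson.word_val copy_Y = copy 0 (zoom True tree_rotation)"
proof -
  let ?x = tree_rotation and ?y = "zoom True tree_rotation"
  have "?y + copy 0 ?y = zoom True (copy 0 ?x) + ?y"
    using arg_cong[OF tree_rotation_zoom_False_True[of ?x], of "zoom True"]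
    by (simp add: zoom_add copy_def)
  also have "zoom True (copy 0 ?x) = ?x + (copy 0 ?x + - ?x)"
    using conj_tree_rotation[of "zoom False ?x"] by (simp add: copy_def)
  finally have "copy 0 ?y = - ?y + (?x + (copy 0 ?x + - ?x) + ?y)"
    by (metis minus_add_cancel)
  thus ?thesis
    by (simp only: copy_Y_def word_val_copy_X thompson.word_val_simps letter_val.simps prod.case
        if_True if_False add.assoc add_0_right)
qed

lemma word_val_inverse: "thompson.word_val (word_inverse u) = - thompson.word_val u"
  by (induction u) (auto simp: word_inverse_def minus_add)

lemma ex_copy_word:
  "\<exists>u. thompson.word_val u = copy 0 (letter_elem l) \<and> even (length u) \<and> length u \<le> 10"
proof -
  obtain a b where l: "l = (a, b)" by (cases l)
  have *: "thompson.word_val (copy_word a) = copy 0 (letter_val a)"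
    "even (length (copy_word a))" "length (copy_word a) \<le> 10"
    by (cases a; simp add: word_val_copy_X word_val_copy_Y; simp add: copy_X_def copy_Y_def)+
  show ?thesis
  proof (cases b)
    case True
    thus ?thesis using * l by auto
  next
    case False
    have "thompson.word_val (word_inverse (copy_word a)) = copy 0 (- letter_val a)"
      using * hom_minus[of "copy 0"] copy_add by (simp add: word_val_inverse)
    moreover have "length (word_inverse (copy_word a)) = length (copy_word a)"
      by (simp add: word_inverse_def)
    ultimately show ?thesis using * False l by (intro exI[of _ "word_inverse (copy_word a)"]) simp
  qed
qed

lemma bdry_shift_le:
  assumes "finite S"
  shows "real (bdry S (shift i)) \<le> real i * (\<Sum>p\<in>UNIV. real (bdry S (thompson.two_steps p)))"
proof (induction i)
  case (Suc i)
  have "real (bdry S (tree_rotation + tree_rotation)) \<le>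
      (\<Sum>p\<in>UNIV. real (bdry S (thompson.two_steps p)))"
    using thompson.bdry_word_val_le[OF assms, of "[(X, True), (X, True)]"] by simp
  moreover have "real (bdry S (shift (Suc i))) \<le>
      real (bdry S (tree_rotation + tree_rotation)) + real (bdry S (shift i))"
    using bdry_add_le[OF assms, of "tree_rotation + tree_rotation" "shift i"] by simp
  ultimately show ?case using Suc by (simp add: algebra_simps)
qed (simp add: bdry_def)

text \<open>There are 16 pairs of letters, and the copy of each pair is an even word of at most 20
  letters, that is, at most 10 double steps.\<close>

lemma sum_bdry_copy_le:
  assumes S: "finite S"
  shows "(\<Sum>p\<in>UNIV. real (bdry S (copy 0 (thompson.two_steps p)))) \<le>
    160 * (\<Sum>p\<in>UNIV. real (bdry S (thompson.two_steps p)))" (is "_ \<le> 160 * ?D")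
proof -
  have D: "?D \<ge> 0" by (simp add: sum_nonneg)
  have "real (bdry S (copy 0 (thompson.two_steps p))) \<le> 10 * ?D" for p
  proof -
    obtain k l where p: "p = (k, l)" by (cases p)
    obtain u where u: "thompson.word_val u = copy 0 (letter_elem k)" "even (length u)" "length u \<le> 10"
      using ex_copy_word by blast
    obtain v where v: "thompson.word_val v = copy 0 (letter_elem l)" "even (length v)" "length v \<le> 10"
      using ex_copy_word by blast
    have "copy 0 (thompson.two_steps p) = thompson.word_val (u @ v)"
      by (simp add: p thompson.two_steps_def copy_add u v)
    hence "real (bdry S (copy 0 (thompson.two_steps p))) \<le> real (length (u @ v) div 2) * ?D"
      using thompson.bdry_word_val_le[OF S, of "u @ v"] u v by simp
    also have "\<dots> \<le> 10 * ?D" using u v D by (intro mult_right_mono) auto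
    finally show ?thesis .
  qed
  hence "(\<Sum>p\<in>UNIV. real (bdry S (copy 0 (thompson.two_steps p)))) \<le>
      (\<Sum>p\<in>(UNIV :: ((thompson_gen \<times> bool) \<times> thompson_gen \<times> bool) set). 10 * ?D)"
    by (intro sum_mono) auto
  also have "\<dots> = 160 * ?D" using card_letters by simp
  finally show ?thesis .
qed

text \<open>With fewer than 4 points, a ratio below \<open>1 / 4\<close> makes the integral boundary
  zero. The set is then closed under a step of infinite order, so it is infinite.\<close>

lemma isoperimetric_base: "isoperimetric UNIV thompson.two_steps (1 / 4) (ln 4)"
  unfolding isoperimetric_def
proof (intro allI impI, rule ccontr)
  fix S :: "bool stream bijection set"
  assume S: "finite S \<and> S \<noteq> {} \<and> ln (card S) < ln 4"
  assume less: "\<not> 1 / 4 * real (card S) \<le> (\<Sum>p\<in>UNIV. real (bdry S (thompson.two_steps p)))"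
  have "card S > 0" using S by (simp add: card_gt_0_iff)
  hence "real (card S) < 4" using S by (simp del: of_nat_less_numeral_iff)
  hence "(\<Sum>p\<in>UNIV. real (bdry S (thompson.two_steps p))) < 1" using less by linarith
  moreover have "real (bdry S (shift 1)) \<le> (\<Sum>p\<in>UNIV. real (bdry S (thompson.two_steps p)))"
    using bdry_shift_le[of S 1] S by simp
  ultimately have "bdry S (tree_rotation + tree_rotation) = 0" by simp
  hence closed: "s + (tree_rotation + tree_rotation) \<in> S" if "s \<in> S" for s
    using S that by (auto simp: bdry_def)
  have closed': "s + shift i \<in> S" if "s \<in> S" for s i
    using that closed by (induction i arbitrary: s)
      (auto simp: shift_add_shift_Suc simp del: shift.simps(2))
  obtain s where "s \<in> S" using S by blast
  hence "range (\<lambda>i. s + shift i) \<subseteq> S" using closed' by blast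
  moreover have "inj (\<lambda>i. s + shift i)" using inj_shift by (auto simp: inj_def)
  ultimately show False using S by (meson finite_subset range_inj_infinite)
qed

text \<open>The factor 640 is \<open>4 * C\<close> with \<open>C = 160\<close>. Each round
  multiplies \<open>L\<close> by at least \<open>1 / (8 * \<eta>)\<close>, which is at least 1, so
  \<open>ln 4 \<le> L\<close> persists.\<close>

lemma isoperimetric_iterate:
  assumes \<eta>: "0 < \<eta>" "\<eta> \<le> 1 / 8"
  shows "isoperimetric UNIV thompson.two_steps (\<eta> / 640 ^ d) (ln 4 / (8 * \<eta>) ^ d)"
proof (induction d)
  case 0
  show ?case by (rule isoperimetric_mono[OF isoperimetric_base]) (use \<eta> in auto)
next
  case (Suc d)
  let ?\<eta> = "\<eta> / 640 ^ d" and ?L = "ln (4::real) / (8 * \<eta>) ^ d"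
  have le: "?\<eta> \<le> \<eta>" using \<eta> by (simp add: field_simps)
  have pow: "0 < (8 * \<eta>) ^ d" "(8 * \<eta>) ^ d \<le> 1"
    by (rule zero_less_power, use \<eta> in simp) (rule power_le_one, use \<eta> in simp_all)
  have L: "ln 4 \<le> ?L" using divide_left_mono[OF pow(2), of "ln 4"] pow(1) by simp
  have step: "isoperimetric UNIV thompson.two_steps (?\<eta> / (4 * 160)) (?L / (8 * ?\<eta>))"
  proof (rule isoperimetric_step[OF Suc.IH, where j = copy and H = fixes_from and tr = shift])
    show "0 < ?\<eta>" using \<eta> by simp
    show "?\<eta> \<le> 1" using \<eta> le by linarith
    show "ln 4 \<le> ?L" by (rule L)
    show "(2::real) \<le> 160" by simp
    show "inj (copy i)" for i by (rule inj_copy)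
    show "0 \<in> fixes_from i" for i by (simp add: fixes_from_def)
    show "fixes_from i \<inter> range (copy i) \<subseteq> {0}" for i using fixes_from_copy by auto
  qed (use copy_add fixes_from_subgroup range_copy_fixes fixes_from_mono shift_copy bdry_shift_le
      sum_bdry_copy_le in auto)
  have "\<eta> / 640 ^ Suc d \<le> ?\<eta> / (4 * 160)" by simp
  moreover have "ln 4 / (8 * \<eta>) ^ Suc d \<le> ?L / (8 * ?\<eta>)"
  proof -
    have "ln 4 / (8 * \<eta>) ^ Suc d = ?L / (8 * \<eta>)" by simp
    also have "\<dots> \<le> ?L / (8 * ?\<eta>)"
    proof (rule divide_left_mono)
      show "8 * ?\<eta> \<le> 8 * \<eta>" using le by linarith
      show "0 \<le> ?L" using L ln_ge_zero[of 4] by linarith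
      show "0 < 8 * \<eta> * (8 * ?\<eta>)" using \<eta> by simp
    qed
    finally show ?thesis .
  qed
  ultimately show ?case by (rule isoperimetric_mono[OF step])
qed

section \<open>From loops in the Cayley graph to closed walks of bijections\<close>

text \<open>Choosing one letter for each element of \<open>thompson_S\<close> sends loops
  injectively to words that act trivially.\<close>

lemma cogrowth_le_walks: "real (thompson_cogrowth n) \<le> thompson.walks (2 * n) 0"
proof -
  let ?R = thompson_relations
  interpret F: group thompson_F by (rule group_thompson_F)
  let ?W = "{w. set w \<subseteq> thompson_S \<and> length w = 2 * n \<and>
    foldr (\<otimes>\<^bsub>thompson_F\<^esub>) w \<one>\<^bsub>thompson_F\<^esub> = \<one>\<^bsub>thompson_F\<^esub>}"
  have sub: "thompson_S \<subseteq> carrier thompson_F"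
    by (auto simp: thompson_S_def thompson_x_def thompson_y_def thompson_F_def
        inv_presented_group carrier_presented_group)
  have "\<exists>l. word_class ?R [l] = s" if "s \<in> thompson_S" for s
    using that by (auto simp: thompson_S_def thompson_x_def thompson_y_def thompson_F_def
        inv_presented_group word_inverse_def)
  then obtain letter where letter: "\<And>s. s \<in> thompson_S \<Longrightarrow> word_class ?R [letter s] = s"
    by metis
  have prod: "foldr (\<otimes>\<^bsub>thompson_F\<^esub>) w \<one>\<^bsub>thompson_F\<^esub> = word_class ?R (map letter w)"
    if "set w \<subseteq> thompson_S" for w
    using that
  proof (induction w)
    case Nil
    show ?case by (simp add: thompson_F_def one_presented_group)
  next
    case (Cons s w)
    have "s \<otimes>\<^bsub>thompson_F\<^esub> word_class ?R (map letter w) =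
        word_class ?R [letter s] \<otimes>\<^bsub>thompson_F\<^esub> word_class ?R (map letter w)"
      using letter[of s] Cons.prems by simp
    thus ?case using Cons by (simp add: thompson_F_def mult_presented_group)
  qed
  let ?U = "{u. length u = 2 * n \<and> 0 + thompson.word_val u = 0}"
  have "map letter ` ?W \<subseteq> ?U"
  proof clarify
    fix w assume w: "set w \<subseteq> thompson_S" "length w = 2 * n"
      "foldr (\<otimes>\<^bsub>thompson_F\<^esub>) w \<one>\<^bsub>thompson_F\<^esub> = \<one>\<^bsub>thompson_F\<^esub>"
    hence "word_class ?R (map letter w) = word_class ?R []"
      using prod[of w] by (simp add: thompson_F_def one_presented_group)
    hence "thompson.word_val (map letter w) = thompson.word_val []"
      by (intro word_val_eq) (simp add: word_class_eq_iff)
    thus "length (map letter w) = 2 * n \<and> 0 + thompson.word_val (map letter w) = 0"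
      using w by simp
  qed
  moreover have "inj_on (map letter) ?W"
  proof (rule inj_onI)
    fix v w assume "v \<in> ?W" "w \<in> ?W" and eq: "map letter v = map letter w"
    hence v: "v = map (\<lambda>s. word_class ?R [letter s]) v"
      and w: "map (\<lambda>s. word_class ?R [letter s]) w = w"
      using letter by (auto intro!: map_idI map_idI[symmetric])
    have vw: "map (\<lambda>s. word_class ?R [letter s]) v = map (\<lambda>s. word_class ?R [letter s]) w"
      using arg_cong[OF eq, of "map (\<lambda>l. word_class ?R [l])"] by (simp add: comp_def)
    show "v = w" by (rule v[THEN HOL.trans, OF vw[THEN HOL.trans, OF w]])
  qed
  moreover have "finite ?U"
    by (rule finite_subset[OF _ finite_lists_length_eq[of UNIV "2 * n"]]) auto
  ultimately have "card ?W \<le> card ?U" by (intro card_inj_on_le[of "map letter"])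
  thus ?thesis
    unfolding thompson_cogrowth_def F.card_loops_eq_words[OF sub]
    by (simp flip: thompson.card_words_eq_walks)
qed

section \<open>The return probability\<close>

text \<open>Taking \<open>8 * \<eta>\<close> equal to \<open>n\<close> to the power
  \<open>-1 / (d + 2)\<close> balances the two alternatives of \<open>walks_dichotomy\<close>: both
  exponents become multiples of \<open>real n powr (d / (d + 2))\<close>.\<close>

lemma cogrowth_bound:
  "\<exists>c>0. \<forall>n>0. real (thompson_cogrowth n) \<le>
    16 ^ n * (2 * exp (- (c * real n powr (real d / real (d + 2)))))"
proof -
  define b where "b = real d / real (d + 2)"
  \<comment> \<open>The first entry suits the alternative with \<open>L\<close>, as
    \<open>ln 4\<close> is at least 1. The second is \<open>\<eta>\<^sup>2 / 8192\<close> after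
    rescaling, without \<open>r\<^sup>2\<close>; 8192 is \<open>32 * 4 ^ 4\<close> and 64 comes from
    \<open>\<eta> = r / 8\<close>.\<close>
  define c where "c = min 1 (1 / (64 * (640 ^ d)\<^sup>2 * 8192 :: real))"
  have c: "c > 0" "c \<le> 1" "c \<le> 1 / (64 * (640 ^ d)\<^sup>2 * 8192)" by (auto simp: c_def)
  have "real (thompson_cogrowth n) \<le> 16 ^ n * (2 * exp (- (c * real n powr b)))"
    if n: "n > 0" for n
  proof -
    define r where "r = real n powr (- 1 / (d + 2))"
    define \<eta> where "\<eta> = r / 8"
    have "r \<le> real n powr 0"
      unfolding r_def using n by (intro powr_mono) auto
    hence r: "0 < r" "r \<le> 1" using n by (simp_all add: r_def)
    hence \<eta>: "0 < \<eta>" "\<eta> \<le> 1 / 8" by (simp_all add: \<eta>_def)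
    define L where "L = ln 4 / (8 * \<eta>) ^ d"
    have rd: "r ^ d = real n powr (- b)"
      unfolding r_def b_def using n by (simp add: powr_realpow[symmetric] powr_powr)
    have r2: "real n * r\<^sup>2 = real n powr b"
    proof -
      have "real n * r\<^sup>2 = real n powr 1 * real n powr (- 2 / (d + 2))"
        using n by (simp add: r_def powr_realpow[symmetric] powr_powr)
      also have "\<dots> = real n powr b"
        unfolding powr_add[symmetric] b_def by (simp add: field_simps)
      finally show ?thesis .
    qed
    have "exp 1 \<le> (4 :: real)" using exp_le by linarith
    hence "ln (exp 1) \<le> ln (4 :: real)" by (intro ln_mono) auto
    hence ln4: "1 \<le> ln (4 :: real)" by simp
    have "L = ln 4 * real n powr b"
      unfolding L_def \<eta>_def by (simp add: rd powr_minus_divide)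
    hence L: "L \<ge> c * real n powr b"
      using c(2) ln4 by (simp add: mult_right_mono)
    let ?\<eta> = "\<eta> / 640 ^ d"
    have q: "real CARD(thompson_gen \<times> bool) = 4" by (simp only: card_letters of_nat_numeral)
    have pow16: "(4::real) ^ (2 * n) = 16 ^ n" by (simp add: power_mult)
    have "isoperimetric UNIV thompson.two_steps ?\<eta> L"
      unfolding L_def by (rule isoperimetric_iterate[OF \<eta>])
    from thompson.walks_dichotomy[OF this, of n]
    have "thompson.walks (2 * n) 0 \<le> 2 * exp (- L) * 16 ^ n \<or>
        thompson.walks (2 * n) 0 \<le> 16 ^ n * (1 - ?\<eta>\<^sup>2 / 8192) ^ n"
      unfolding q pow16 using \<eta> by simp
    thus ?thesis
    proof
      assume "thompson.walks (2 * n) 0 \<le> 2 * exp (- L) * 16 ^ n"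
      also have "\<dots> \<le> 16 ^ n * (2 * exp (- (c * real n powr b)))" using L by simp
      finally show ?thesis using cogrowth_le_walks[of n] by linarith
    next
      define e where "e = ?\<eta>\<^sup>2 / 8192"
      have "?\<eta> \<le> 1"
        using \<eta> by (simp add: divide_le_eq) (use one_le_power[of "640::real" d] in linarith)
      hence "?\<eta>\<^sup>2 \<le> 1" using \<eta> by (simp add: power_le_one)
      hence e: "e \<le> 1" by (simp add: e_def)
      have "real n * e = real n * r\<^sup>2 * (1 / (64 * (640 ^ d)\<^sup>2 * 8192))"
        by (simp add: e_def \<eta>_def power_divide)
      hence ne: "c * real n powr b \<le> real n * e"
        unfolding r2 using mult_right_mono[OF c(3), of "real n powr b"] by (simp add: mult.commute)
      assume "thompson.walks (2 * n) 0 \<le> 16 ^ n * (1 - ?\<eta>\<^sup>2 / 8192) ^ n"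
      also have "\<dots> = 16 ^ n * (1 - e) ^ n" by (simp add: e_def)
      also have "(1 - e) ^ n \<le> exp (- e) ^ n"
        using e exp_ge_add_one_self[of "- e"] by (intro power_mono) auto
      also have "exp (- e) ^ n = exp (- (real n * e))" by (simp add: exp_of_nat_mult[symmetric])
      also have "\<dots> \<le> exp (- (c * real n powr b))" using ne by simp
      also have "\<dots> \<le> 2 * exp (- (c * real n powr b))" by simp
      finally show ?thesis using cogrowth_le_walks[of n] by simp
    qed
  qed
  thus ?thesis using c(1) unfolding b_def by blast
qed

theorem theorem3p2:
  fixes a lam :: real
  assumes "a < 1" and "lam > 1"
  shows "\<forall>\<^sub>F n in sequentially.
    real (thompson_cogrowth n) < 16 ^ n * lam powr (- (real n powr a))"
proof -
  \<comment> \<open>Makes the exponent nonnegative, so that \<open>b\<close> is positive and the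
    constant \<open>ln 2\<close> is of lower order too.\<close>
  define a' where "a' = max a 0"
  obtain d :: nat where d: "2 / (1 - a') < real d" using reals_Archimedean2 by blast
  define b where "b = real d / real (d + 2)"
  have a': "0 \<le> a'" "a' < 1" "a \<le> a'" using assms by (auto simp: a'_def)
  have "2 < real d * (1 - a')" using d a' by (simp add: field_simps)
  hence "a' * (real d + 2) < real d" using a' by (simp add: algebra_simps)
  hence b: "a' < b" by (simp add: b_def field_simps)
  obtain c where c: "c > 0" "\<And>n. n > 0 \<Longrightarrow> real (thompson_cogrowth n) \<le>
      16 ^ n * (2 * exp (- (c * real n powr b)))"
    using cogrowth_bound[of d] unfolding b_def by blast
  \<comment> \<open>Divided by \<open>real n powr b\<close>, both the target exponent and the
    logarithm of the factor 2 tend to 0, so they are eventually beaten by \<open>c\<close>.\<close>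
  have "(\<lambda>n. ln lam * real n powr (a' - b) + ln 2 * real n powr (- b)) \<longlonglongrightarrow> ln lam * 0 + ln 2 * 0"
    using a' b by (intro tendsto_intros tendsto_neg_powr filterlim_real_sequentially) auto
  hence "\<forall>\<^sub>F n in sequentially. ln lam * real n powr (a' - b) + ln 2 * real n powr (- b) < c"
    using c(1) by (intro order_tendstoD(2)) auto
  thus ?thesis using eventually_gt_at_top[of 0]
  proof eventually_elim
    case (elim n)
    have "(ln lam * real n powr (a' - b) + ln 2 * real n powr (- b)) * real n powr b < c * real n powr b"
      using elim by (intro mult_strict_right_mono) auto
    hence "ln lam * real n powr a' + ln 2 < c * real n powr b"
      using elim by (simp add: distrib_right mult.assoc powr_add[symmetric])
    moreover have "ln lam * real n powr a \<le> ln lam * real n powr a'"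
      using elim a' assms by (intro mult_left_mono powr_mono) auto
    ultimately have "ln 2 + - (c * real n powr b) < - (ln lam * real n powr a)" by linarith
    hence "exp (ln 2 + - (c * real n powr b)) < exp (- (ln lam * real n powr a))" by simp
    also have "exp (ln 2 + - (c * real n powr b)) = 2 * exp (- (c * real n powr b))"
      by (simp only: exp_add) simp
    also have "exp (- (ln lam * real n powr a)) = lam powr (- (real n powr a))"
      using assms by (simp add: powr_def[of lam] mult.commute)
    finally have "2 * exp (- (c * real n powr b)) < lam powr (- (real n powr a))" .
    thus ?case using c(2)[of n] elim by (smt (verit) mult_strict_left_mono zero_less_power)
  qed
qed

end
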